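(* Let $U=U_1\times\cdots\times U_m$ be a Cartesian product of nonempty finite sets. For a set $S\subseteq U$, the following conditions are equivalent: (1) $S$ is ample; (2) $S$ is isometric and both $S^e$ and $S_e$ are ample for some elementary minor-subproduct $e$; (3) $S$ is connected and $S^e$ is ample for every elementary minor-subproduct $e$; (4) $S\cap[u,v]$ is ample in $[u,v]$ for all $u,v\in S$.
   Context: A generalized partition of a finite product $Z=Z_1\times\cdots\times Z_m$ of nonempty sets is a tuple $\Lambda=(\alpha_1,\dots,\alpha_m)$ with $\alpha_i$ a partition of $Z_i$ into nonempty blocks. It defines a partition of $Z$ into the boxes $P^1\times\cdots\times P^m$, $P^i\in\alpha_i$, and the minor-subproduct $M(\Lambda)=M_1\times\cdots\times M_m$, where $M_i$ is the set of blocks of $\alpha_i$; elements of $M(\Lambda)$ are identified with boxes. $M(\Lambda)$ is shattered by $S\subseteq Z$ if $S$ meets every box of the box-partition. A copy of $M(\Lambda)$ is a set $W_1\times\cdots\times W_m$ where $W_i$ consists of exactly one element from each block of $\alpha_i$. $M(\Lambda)$ is strongly shattered by $S$ if $S$ contains a copy of it. $S$ is ample in $Z$ if every minor-subproduct of $Z$ shattered by $S$ is strongly shattered by $S$. "Ample" for $S\subseteq U$ means ample in $U$. A minor-subproduct $e$ of $U$ is elementary if all blocks of all partitions $\alpha_i$ are singletons, except exactly one block of one partition, which has size 2. For $S\subseteq U$, $S_e$ (resp. $S^e$) is the set of elements of $e$ whose corresponding box meets $S$ (resp. is contained in $S$). Ampleness of $S^e$ and $S_e$ is meant in the product $e=M_1\times\cdots\times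 M_m$. The Hamming graph of $U$ has vertex set $U$, two tuples being adjacent iff they differ in exactly one coordinate; the distance is the number of differing coordinates. $S$ is connected if it induces a connected subgraph, and isometric if any $u,v\in S$ are joined by a path in $S$ of length equal to their Hamming distance (the empty set counts as connected and isometric). The interval is $[u,v]=\{u_1,v_1\}\times\cdots\times\{u_m,v_m\}$, itself regarded as a product.
   Formalization: The equivalence of (1) and (2) is stated only when some U_i has at least two elements; if all U_i are singletons there is no elementary minor-subproduct, so (2) fails while (1), (3) and (4) hold. *)

theory Defs
  imports "HOL-Library.FuncSet" "HOL-Library.Disjoint_Sets"
begin

(* A product of m factors is given by a family Z of sets, of which only Z 0, ..., Z (m - 1)
   matter. The type of the entries is a parameter, since the factors of a minor-subproduct
   are sets of blocks. *)
abbreviation cart :: "nat \<Rightarrow> (nat \<Rightarrow> 'a set) \<Rightarrow> (nat \<Rightarrow> 'a) set" where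
  "cart m Z \<equiv> PiE {..<m} Z"

definition gen_partitions :: "nat \<Rightarrow> (nat \<Rightarrow> 'a set) \<Rightarrow> (nat \<Rightarrow> 'a set set) set" where
  "gen_partitions m Z = (\<Pi>\<^sub>E i\<in>{..<m}. {P. partition_on (Z i) P})"

(* The minor-subproduct of a generalized partition L of Z is cart m L: its factors are the
   sets of blocks L i, and its element P corresponds to the box cart m P. *)

definition shattered :: "nat \<Rightarrow> (nat \<Rightarrow> 'a set set) \<Rightarrow> (nat \<Rightarrow> 'a) set \<Rightarrow> bool" where
  "shattered m L S \<longleftrightarrow> (\<forall>P\<in>cart m L. cart m P \<inter> S \<noteq> {})"

definition is_copy :: "nat \<Rightarrow> (nat \<Rightarrow> 'a set set) \<Rightarrow> (nat \<Rightarrow> 'a) set \<Rightarrow> bool" where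
  "is_copy m L C \<longleftrightarrow>
     (\<exists>W. C = cart m W \<and> (\<forall>i<m. W i \<subseteq> \<Union>(L i) \<and> (\<forall>B\<in>L i. \<exists>!x. x \<in> W i \<inter> B)))"

definition strongly_shattered :: "nat \<Rightarrow> (nat \<Rightarrow> 'a set set) \<Rightarrow> (nat \<Rightarrow> 'a) set \<Rightarrow> bool" where
  "strongly_shattered m L S \<longleftrightarrow> (\<exists>C. is_copy m L C \<and> C \<subseteq> S)"

definition ample :: "nat \<Rightarrow> (nat \<Rightarrow> 'a set) \<Rightarrow> (nat \<Rightarrow> 'a) set \<Rightarrow> bool" where
  "ample m Z S \<longleftrightarrow> S \<subseteq> cart m Z \<and>
     (\<forall>L\<in>gen_partitions m Z. shattered m L S \<longrightarrow> strongly_shattered m L S)"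

definition elementary :: "nat \<Rightarrow> (nat \<Rightarrow> 'a set set) \<Rightarrow> bool" where
  "elementary m L \<longleftrightarrow>
     (\<exists>j<m. \<exists>B\<in>L j. card B = 2 \<and>
        (\<forall>i<m. \<forall>C\<in>L i. (i, C) \<noteq> (j, B) \<longrightarrow> card C = 1))"

(* Only the generalized partition is recorded; it determines the minor-subproduct. *)
definition elementary_minors :: "nat \<Rightarrow> (nat \<Rightarrow> 'a set) \<Rightarrow> (nat \<Rightarrow> 'a set set) set" where
  "elementary_minors m Z = {L \<in> gen_partitions m Z. elementary m L}"

(* S_e is minor_meet m e S and S^e is minor_contained m e S; both are subsets of cart m e. *)
definition minor_meet :: "nat \<Rightarrow> (nat \<Rightarrow> 'a set set) \<Rightarrow> (nat \<Rightarrow> 'a) set \<Rightarrow> (nat \<Rightarrow> 'a set) set" where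
  "minor_meet m e S = {P \<in> cart m e. cart m P \<inter> S \<noteq> {}}"

definition minor_contained :: "nat \<Rightarrow> (nat \<Rightarrow> 'a set set) \<Rightarrow> (nat \<Rightarrow> 'a) set \<Rightarrow> (nat \<Rightarrow> 'a set) set" where
  "minor_contained m e S = {P \<in> cart m e. cart m P \<subseteq> S}"

definition hamming_dist :: "nat \<Rightarrow> (nat \<Rightarrow> 'a) \<Rightarrow> (nat \<Rightarrow> 'a) \<Rightarrow> nat" where
  "hamming_dist m u v = card {i. i < m \<and> u i \<noteq> v i}"

definition hamming_adj :: "nat \<Rightarrow> (nat \<Rightarrow> 'a) \<Rightarrow> (nat \<Rightarrow> 'a) \<Rightarrow> bool" where
  "hamming_adj m u v \<longleftrightarrow> (\<exists>!i. i < m \<and> u i \<noteq> v i)"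

(* A path is the list of its vertices; its length is the number of edges. *)
definition hamming_path ::
    "nat \<Rightarrow> (nat \<Rightarrow> 'a) set \<Rightarrow> (nat \<Rightarrow> 'a) \<Rightarrow> (nat \<Rightarrow> 'a) list \<Rightarrow> (nat \<Rightarrow> 'a) \<Rightarrow> bool" where
  "hamming_path m S u p v \<longleftrightarrow>
     p \<noteq> [] \<and> hd p = u \<and> last p = v \<and> set p \<subseteq> S \<and> distinct p \<and> successively (hamming_adj m) p"

definition hamming_connected :: "nat \<Rightarrow> (nat \<Rightarrow> 'a) set \<Rightarrow> bool" where
  "hamming_connected m S \<longleftrightarrow> (\<forall>u\<in>S. \<forall>v\<in>S. \<exists>p. hamming_path m S u p v)"

definition hamming_isometric :: "nat \<Rightarrow> (nat \<Rightarrow> 'a) set \<Rightarrow> bool" where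
  "hamming_isometric m S \<longleftrightarrow>
     (\<forall>u\<in>S. \<forall>v\<in>S. \<exists>p. hamming_path m S u p v \<and> length p - 1 = hamming_dist m u v)"

definition interval_factors :: "(nat \<Rightarrow> 'a) \<Rightarrow> (nat \<Rightarrow> 'a) \<Rightarrow> nat \<Rightarrow> 'a set" where
  "interval_factors u v = (\<lambda>i. {u i, v i})"

end

theory Submission
  imports Defs
begin

text \<open>
  Ampleness passes to subboxes: if \<open>A \<subset> U j\<close> and adding the block \<open>U j - A\<close> to a shattered partition
  destroys shattering, then some pattern is only met inside \<open>A\<close>, which pins down the copy obtained
  after joining \<open>U j - A\<close> to one of the blocks. Hence (1) implies (4), and intervals show that ample
  sets are isometric.

  (2) implies (1): let \<open>e\<close> merge \<open>a, b \<in> U j\<close>. The complement of an ample set is never split into two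
  nonempty parts without edges between them; applied to \<open>S\<^sup>e\<close> in a copy found in \<open>S\<^sub>e\<close>, this shows that
  a column of the copy over \<open>{a, b}\<close> can be taken to be constantly \<open>a\<close> or constantly \<open>b\<close>. If \<open>a\<close> and
  \<open>b\<close> lie in different blocks, comparing which patterns meet these blocks outside \<open>a\<close> and \<open>b\<close> reduces
  the search for a copy to a coarser partition of \<open>e\<close>.

  (3) implies (1): a path that leaves \<open>a\<close> for \<open>b\<close> and later changes the same coordinate again can be
  rerouted inside \<open>S\<^sup>e\<close>, so \<open>S\<close> is isometric. If every pattern meets some block in two points, merge
  two points of this block; otherwise all blocks have a pattern that meets them in a single point, and
  merging two such points of different blocks gives a copy.

  (4) implies (1): in a smallest counterexample every non-singleton block is a whole factor and some
  factor consists of two singleton blocks; then \<open>S\<^sup>e\<close> for this factor is a smaller counterexample.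
\<close>

section \<open>Labellings\<close>

text \<open>In the directions towards (1), a copy found in a minor is a copy in \<open>S\<close>
  except over the merged point: a point of \<open>S\<^sub>e\<close> there lifts to \<open>a\<close>
  or to \<open>b\<close> without control, while a point of \<open>S\<^sup>e\<close> lifts to both.
  Isometry produces points of \<open>S\<^sup>e\<close>: a geodesic from coordinate \<open>a\<close>
  to coordinate \<open>b\<close> crosses an edge in direction \<open>j\<close>, and this edge keeps
  all labels in which the two ends of the geodesic agree. That \<open>S\<^sub>e\<close> and
  \<open>S\<^sup>e\<close> inherit ampleness from \<open>S\<close> is again relabelling. For
  \<open>S\<^sub>e\<close> the labels are pulled back along the merging map. For
  \<open>S\<^sup>e\<close> a copy in \<open>S\<close> must contain, with each point at
  \<open>a\<close>, its twin at \<open>b\<close>. If all patterns of the other coordinates occur in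
  \<open>S\<close> at \<open>b\<close> (or all at \<open>a\<close>), this value gets a label of its
  own, whose column supplies the twins. Otherwise one pattern does not occur at \<open>b\<close> and
  another not at \<open>a\<close>, so that a copy for the merged labels avoids both values.\<close>

text \<open>A partition of \<open>Z i\<close> is encoded by a labelling \<open>f i\<close> whose fibres are the blocks, so that blocks
  can be split and merged by relabelling. A pattern of labels is represented by a point \<open>z\<close> realising
  it, and a copy by functions \<open>w i\<close> choosing a point for each label.\<close>

definition label_shattered :: "nat \<Rightarrow> (nat \<Rightarrow> 'a set) \<Rightarrow> (nat \<Rightarrow> 'a \<Rightarrow> 'k) \<Rightarrow> (nat \<Rightarrow> 'a) set \<Rightarrow> bool" where
  "label_shattered m Z f S \<longleftrightarrow> (\<forall>z\<in>cart m Z. \<exists>s\<in>S. \<forall>i<m. f i (s i) = f i (z i))"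

definition select :: "nat \<Rightarrow> (nat \<Rightarrow> 'k \<Rightarrow> 'b) \<Rightarrow> (nat \<Rightarrow> 'a \<Rightarrow> 'k) \<Rightarrow> (nat \<Rightarrow> 'a) \<Rightarrow> nat \<Rightarrow> 'b" where
  "select m w f z = (\<lambda>i\<in>{..<m}. w i (f i (z i)))"

definition label_copy :: "nat \<Rightarrow> (nat \<Rightarrow> 'a set) \<Rightarrow> (nat \<Rightarrow> 'a \<Rightarrow> 'k) \<Rightarrow> (nat \<Rightarrow> 'a) set \<Rightarrow> (nat \<Rightarrow> 'k \<Rightarrow> 'a) \<Rightarrow> bool" where
  "label_copy m Z f S w \<longleftrightarrow>
     (\<forall>i<m. \<forall>x\<in>Z i. f i (w i (f i x)) = f i x) \<and> (\<forall>z\<in>cart m Z. select m w f z \<in> S)"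

lemma select_apply [simp]: "i < m \<Longrightarrow> select m w f z i = w i (f i (z i))"
  by (simp add: select_def)

lemma select_cong:
  assumes "\<And>i. i < m \<Longrightarrow> w i (f i (z i)) = w' i (f' i (z' i))"
  shows "select m w f z = select m w' f' z'"
  using assms by (auto simp: select_def)

lemma select_upd:
  assumes "j < m" "\<And>i. i < m \<Longrightarrow> i \<noteq> j \<Longrightarrow> w i (f i (z i)) = w' i (f' i (z' i))" "x = w j (f j (z j))"
  shows "(select m w' f' z')(j := x) = select m w f z"
  using assms by (auto simp: select_def fun_eq_iff)

lemma cart_extend:
  assumes "\<And>i. i < m \<Longrightarrow> Z i \<noteq> {}" "j < m" "x \<in> Z j"
  obtains z where "z \<in> cart m Z" "z j = x"
proof -
  obtain z where "z \<in> cart m Z" using assms(1) PiE_eq_empty_iff[of "{..<m}" Z] by blast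
  then have "z(j := x) \<in> cart m Z" using assms by (auto simp: PiE_iff extensional_def)
  then show thesis using that by auto
qed

lemma cart_upd: "z \<in> cart m Z \<Longrightarrow> j < m \<Longrightarrow> x \<in> Z j \<Longrightarrow> z(j := x) \<in> cart m Z"
  by (auto simp: PiE_iff extensional_def)

lemma label_copyD1: "label_copy m Z f S w \<Longrightarrow> i < m \<Longrightarrow> x \<in> Z i \<Longrightarrow> f i (w i (f i x)) = f i x"
  by (simp add: label_copy_def)

lemma label_copyD2: "label_copy m Z f S w \<Longrightarrow> z \<in> cart m Z \<Longrightarrow> select m w f z \<in> S"
  by (simp add: label_copy_def)

lemma label_shatteredD:
  assumes "label_shattered m Z f S" "z \<in> cart m Z"
  obtains s where "s \<in> S" "\<forall>i<m. f i (s i) = f i (z i)"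
  using assms unfolding label_shattered_def by blast

lemma ample_subset: "ample m Z S \<Longrightarrow> S \<subseteq> cart m Z"
  by (simp add: ample_def)

text \<open>The label type is arbitrary here, while \<open>ampleI\<close> asks for labels of type
  \<open>'a set\<close> only. A proof of ampleness may therefore answer a given labelling by one
  with more labels on a set already known to be ample, for instance with values of an
  \<open>option\<close> type.\<close>

lemma ampleD:
  fixes f :: "nat \<Rightarrow> 'a \<Rightarrow> 'k"
  assumes ample: "ample m Z S" and shat: "label_shattered m Z f S"
  obtains w where "label_copy m Z f S w"
proof -
  define blk where "blk i x = {y \<in> Z i. f i y = f i x}" for i x
  define L where "L = (\<lambda>i\<in>{..<m}. blk i ` Z i)"
  have SZ: "S \<subseteq> cart m Z" using ample by (simp add: ample_def)
  have "L \<in> gen_partitions m Z"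
    unfolding gen_partitions_def L_def
    by (auto simp: partition_on_def disjoint_def blk_def)
  moreover have "shattered m L S"
    unfolding shattered_def
  proof
    fix P assume P: "P \<in> cart m L"
    have "\<exists>x\<in>Z i. P i = blk i x" if "i < m" for i
      using P that by (auto simp: PiE_iff L_def)
    then obtain z where z: "\<And>i. i < m \<Longrightarrow> z i \<in> Z i \<and> P i = blk i (z i)" by metis
    then have "restrict z {..<m} \<in> cart m Z" by auto
    then obtain s where s: "s \<in> S" "\<forall>i<m. f i (s i) = f i (restrict z {..<m} i)"
      by (rule label_shatteredD[OF shat])
    have "s \<in> cart m P" using s z SZ by (auto simp: PiE_iff blk_def)
    then show "cart m P \<inter> S \<noteq> {}" using s by blast
  qed
  ultimately have "strongly_shattered m L S" using ample by (simp add: ample_def)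
  then obtain W where W: "cart m W \<subseteq> S"
    "\<And>i B. i < m \<Longrightarrow> B \<in> L i \<Longrightarrow> \<exists>!x. x \<in> W i \<inter> B"
    unfolding strongly_shattered_def is_copy_def by auto
  define w where "w i k = (SOME x. x \<in> W i \<and> f i x = k)" for i k
  have w: "w i (f i x) \<in> W i \<and> f i (w i (f i x)) = f i x" if "i < m" "x \<in> Z i" for i x
  proof -
    have "blk i x \<in> L i" using that by (auto simp: L_def)
    then have "\<exists>y. y \<in> W i \<and> f i y = f i x" using W(2)[OF that(1)] unfolding blk_def by blast
    then show ?thesis unfolding w_def by (rule someI_ex)
  qed
  have "label_copy m Z f S w"
    unfolding label_copy_def
  proof (intro conjI allI impI ballI)
    fix z assume z: "z \<in> cart m Z"
    have "select m w f z \<in> cart m W"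
      using w PiE_mem[OF z] by (simp add: select_def restrict_PiE_iff)
    then show "select m w f z \<in> S" using W(1) by blast
  qed (use w in blast)
  then show thesis using that by blast
qed

lemma ampleI:
  fixes Z :: "nat \<Rightarrow> 'a set"
  assumes SZ: "S \<subseteq> cart m Z" and ne: "\<And>i. i < m \<Longrightarrow> Z i \<noteq> {}"
    and copy: "\<And>f :: nat \<Rightarrow> 'a \<Rightarrow> 'a set. label_shattered m Z f S \<Longrightarrow> \<exists>w. label_copy m Z f S w"
  shows "ample m Z S"
  unfolding ample_def
proof (intro conjI ballI impI SZ)
  fix L assume L: "L \<in> gen_partitions m Z" and sh: "shattered m L S"
  have part: "partition_on (Z i) (L i)" if "i < m" for i
    using L that by (auto simp: gen_partitions_def PiE_iff)
  define f where "f i x = (THE B. B \<in> L i \<and> x \<in> B)" for i x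
  have f: "f i x = B" if "i < m" "B \<in> L i" "x \<in> B" for i x B
    unfolding f_def
    using partition_onD2[OF part[OF that(1)]] that by (auto intro!: the_equality dest: disjointD)
  have fL: "f i x \<in> L i \<and> x \<in> f i x" if "i < m" "x \<in> Z i" for i x
    using partition_onD1[OF part[OF that(1)]] that f by blast
  have "label_shattered m Z f S"
    unfolding label_shattered_def
  proof
    fix z assume z: "z \<in> cart m Z"
    have "(\<lambda>i\<in>{..<m}. f i (z i)) \<in> cart m L" using z fL by (auto simp: PiE_iff)
    then obtain s where s: "s \<in> S" "s \<in> cart m (\<lambda>i\<in>{..<m}. f i (z i))"
      using sh unfolding shattered_def by blast
    have "f i (s i) = f i (z i)" if "i < m" for i
      using s(2) z fL f[OF that] that by (auto simp: PiE_iff)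
    then show "\<exists>s\<in>S. \<forall>i<m. f i (s i) = f i (z i)" using s by blast
  qed
  then obtain w where w: "label_copy m Z f S w" using copy by blast
  define W where "W i = w i ` L i" for i
  have lab: "\<exists>x\<in>Z i. B = f i x" if iB: "i < m" "B \<in> L i" for i B
  proof -
    obtain x where "x \<in> B" using partition_onD3[OF part[OF iB(1)]] iB(2) by (metis ex_in_conv)
    then show ?thesis using partition_onD1[OF part[OF iB(1)]] iB f[OF iB] by blast
  qed
  \<comment> \<open>\<open>label_copy\<close> constrains whole points, not single values of
    \<open>w\<close>. That a value lies in its factor is read off after extending \<open>x\<close>
    to a point of the product.\<close>
  have wZ: "w i (f i x) \<in> Z i" if ix: "i < m" "x \<in> Z i" for i x
  proof -
    obtain z where z: "z \<in> cart m Z" "z i = x" by (rule cart_extend[where Z = Z, OF ne ix])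
    then have "select m w f z \<in> cart m Z" using label_copyD2[OF w] SZ by blast
    then have "select m w f z i \<in> Z i" by (rule PiE_mem) (use ix in simp)
    then show ?thesis using z(2) ix(1) by simp
  qed
  have wB: "w i B \<in> B" if iB: "i < m" "B \<in> L i" for i B
    using lab[OF iB] label_copyD1[OF w iB(1)] wZ fL iB(1) by metis
  have "cart m W \<subseteq> S"
  proof
    fix c assume c: "c \<in> cart m W"
    have "\<exists>x\<in>Z i. c i = w i (f i x)" if i: "i < m" for i
    proof -
      obtain B where "B \<in> L i" "c i = w i B" using PiE_mem[OF c, of i] i by (auto simp: W_def)
      then show ?thesis using lab[OF i] by blast
    qed
    then obtain z where z: "\<And>i. i < m \<Longrightarrow> z i \<in> Z i \<and> c i = w i (f i (z i))" by metis
    then have "restrict z {..<m} \<in> cart m Z" by auto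
    then have "select m w f (restrict z {..<m}) \<in> S" by (rule label_copyD2[OF w])
    moreover have "select m w f (restrict z {..<m}) = c"
      using c z by (auto simp: select_def fun_eq_iff PiE_iff extensional_def)
    ultimately show "c \<in> S" by simp
  qed
  moreover have "is_copy m L (cart m W)"
    unfolding is_copy_def
  proof (intro exI[of _ W] conjI allI impI ballI refl)
    fix i assume i: "i < m"
    show "W i \<subseteq> \<Union> (L i)" using wB[OF i] by (auto simp: W_def)
    fix B assume B: "B \<in> L i"
    show "\<exists>!x. x \<in> W i \<inter> B"
    proof (rule ex1I[of _ "w i B"])
      show "w i B \<in> W i \<inter> B" using wB i B by (auto simp: W_def)
      fix x assume "x \<in> W i \<inter> B"
      then obtain B' where "B' \<in> L i" "x = w i B'" "x \<in> B" by (auto simp: W_def)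
      then show "x = w i B" using wB[OF i] f[OF i] B by metis
    qed
  qed
  ultimately show "strongly_shattered m L S" unfolding strongly_shattered_def by blast
qed

text \<open>Serves two purposes: to exchange the two merged points, and to pass between the product
  with \<open>b\<close> deleted and the product of blocks.\<close>

lemma ample_map:
  fixes Z :: "nat \<Rightarrow> 'a set" and Z' :: "nat \<Rightarrow> 'b set"
  assumes ample: "ample m Z S" and ne: "\<And>i. i < m \<Longrightarrow> Z i \<noteq> {}"
    and bij: "\<And>i. i < m \<Longrightarrow> bij_betw (\<phi> i) (Z i) (Z' i)"
  shows "ample m Z' ((\<lambda>x. \<lambda>i\<in>{..<m}. \<phi> i (x i)) ` S)"
proof (rule ampleI)
  have SZ: "S \<subseteq> cart m Z" using ample by (rule ample_subset)
  show "(\<lambda>x. \<lambda>i\<in>{..<m}. \<phi> i (x i)) ` S \<subseteq> cart m Z'"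
    using SZ bij by (auto simp: bij_betw_def PiE_iff subset_iff) blast
  show "Z' i \<noteq> {}" if "i < m" for i using ne[OF that] bij[OF that] by (auto simp: bij_betw_def)
  fix f :: "nat \<Rightarrow> 'b \<Rightarrow> 'b set"
  assume sh: "label_shattered m Z' f ((\<lambda>x. \<lambda>i\<in>{..<m}. \<phi> i (x i)) ` S)"
  define g where "g i x = f i (\<phi> i x)" for i x
  have "label_shattered m Z g S"
    unfolding label_shattered_def
  proof
    fix z assume "z \<in> cart m Z"
    then have "(\<lambda>i\<in>{..<m}. \<phi> i (z i)) \<in> cart m Z'" using bij by (auto simp: PiE_iff bij_betw_def)
    then obtain t where "t \<in> (\<lambda>x. \<lambda>i\<in>{..<m}. \<phi> i (x i)) ` S"
        "\<forall>i<m. f i (t i) = f i ((\<lambda>i\<in>{..<m}. \<phi> i (z i)) i)"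
      by (rule label_shatteredD[OF sh])
    then obtain s where "s \<in> S" "\<forall>i<m. f i (\<phi> i (s i)) = f i (\<phi> i (z i))" by auto
    then show "\<exists>s\<in>S. \<forall>i<m. g i (s i) = g i (z i)" unfolding g_def by blast
  qed
  then obtain w where w: "label_copy m Z g S w" using ampleD[OF ample] by blast
  define w' where "w' i k = \<phi> i (w i k)" for i k
  have inv: "\<exists>x\<in>Z i. y = \<phi> i x" if "i < m" "y \<in> Z' i" for i y
    using bij[OF that(1)] that(2) by (auto simp: bij_betw_def)
  have "label_copy m Z' f ((\<lambda>x. \<lambda>i\<in>{..<m}. \<phi> i (x i)) ` S) w'"
    unfolding label_copy_def
  proof (intro conjI allI impI ballI)
    fix i y assume "i < m" "y \<in> Z' i"
    then show "f i (w' i (f i y)) = f i y"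
      using inv label_copyD1[OF w] by (fastforce simp: g_def w'_def)
  next
    fix z assume z: "z \<in> cart m Z'"
    then have "\<exists>x\<in>Z i. z i = \<phi> i x" if "i < m" for i using inv that by (auto simp: PiE_iff)
    then obtain x where x: "\<And>i. i < m \<Longrightarrow> x i \<in> Z i \<and> z i = \<phi> i (x i)" by metis
    have "select m w g (restrict x {..<m}) \<in> S" using label_copyD2[OF w] x by auto
    moreover have "select m w' f z = (\<lambda>i\<in>{..<m}. \<phi> i (select m w g (restrict x {..<m}) i))"
      using x by (auto simp: select_def w'_def g_def)
    ultimately show "select m w' f z \<in> (\<lambda>x. \<lambda>i\<in>{..<m}. \<phi> i (x i)) ` S" by blast
  qed
  then show "\<exists>w. label_copy m Z' f ((\<lambda>x. \<lambda>i\<in>{..<m}. \<phi> i (x i)) ` S) w" by blast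
qed

section \<open>Restriction to subboxes\<close>

lemma ample_inter_factor:
  assumes ample: "ample m U S" and ne: "\<And>i. i < m \<Longrightarrow> U i \<noteq> {}"
    and j: "j < m" and A: "A \<subseteq> U j" "A \<noteq> {}"
  shows "ample m (U(j := A)) (S \<inter> cart m (U(j := A)))" (is "ample m ?Z ?S")
proof (rule ampleI)
  have SU: "S \<subseteq> cart m U" using ample by (rule ample_subset)
  show "?S \<subseteq> cart m ?Z" by blast
  show neZ: "?Z i \<noteq> {}" if "i < m" for i using ne A that by auto
  have S': "s \<in> ?S \<longleftrightarrow> s \<in> S \<and> s j \<in> A" for s
    using SU j A by (auto simp: PiE_iff)
  have ZU: "z \<in> cart m U" if "z \<in> cart m ?Z" for z
    using that A by (auto simp: PiE_iff split: if_splits)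
  fix f :: "nat \<Rightarrow> 'a \<Rightarrow> 'a set"
  assume sh: "label_shattered m ?Z f ?S"
  \<comment> \<open>\<open>None\<close> is the label of the added block \<open>U j - A\<close>;
    values chosen for labels \<open>Some k\<close> that occur in \<open>A\<close> then stay in
    \<open>A\<close>.\<close>
  define F where "F i x = (if i = j \<and> x \<notin> A then None else Some (f i x))" for i x
  show "\<exists>w. label_copy m ?Z f ?S w"
  proof (cases "label_shattered m U F S")
    case True
    then obtain w where w: "label_copy m U F S w" using ampleD[OF ample] by blast
    define w' where "w' i k = w i (Some k)" for i k
    have 1: "F i (w' i (f i x)) = Some (f i x)" if "i < m" "x \<in> ?Z i" for i x
      using label_copyD1[OF w, of i x] that A by (auto simp: F_def w'_def split: if_splits)
    have "label_copy m ?Z f ?S w'"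
      unfolding label_copy_def
    proof (intro conjI allI impI ballI)
      fix i x assume "i < m" "x \<in> ?Z i"
      then show "f i (w' i (f i x)) = f i x"
        using 1[of i x] by (simp add: F_def split: if_splits)
    next
      fix z assume z: "z \<in> cart m ?Z"
      have "select m w' f z = select m w F z"
        using z by (intro select_cong) (auto simp: F_def w'_def PiE_iff split: if_splits)
      then have "select m w' f z \<in> S" using label_copyD2[OF w] ZU[OF z] by simp
      moreover have "select m w' f z j \<in> A"
        using 1[OF j, of "z j"] PiE_mem[OF z, of j] j by (auto simp: F_def split: if_splits)
      ultimately show "select m w' f z \<in> ?S" by (simp only: S')
    qed
    then show ?thesis by blast
  next
    case False
    then obtain z where z: "z \<in> cart m U" "\<forall>s\<in>S. \<exists>i<m. F i (s i) \<noteq> F i (z i)"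
      by (auto simp: label_shattered_def)
    \<comment> \<open>Patterns with \<open>z j\<close> in \<open>A\<close> are met by assumption, so
      the unmet pattern uses the added block: no point of \<open>S\<close> outside \<open>A\<close>
      has the labels of \<open>z\<close> in the other coordinates.\<close>
    have zj: "z j \<notin> A"
    proof
      assume "z j \<in> A"
      then have zZ: "z \<in> cart m ?Z" using z by (auto simp: PiE_iff)
      then obtain s where "s \<in> ?S" "\<forall>i<m. f i (s i) = f i (z i)"
        by (rule label_shatteredD[OF sh])
      then have "s \<in> S" "\<And>i. i < m \<Longrightarrow> F i (s i) = F i (z i)"
        using \<open>z j \<in> A\<close> S' by (auto simp: F_def)
      then show False using z(2) by blast
    qed
    obtain a where a: "a \<in> A" using A by blast
    define G where "G i x = f i (if i = j \<and> x \<notin> A then a else x)" for i x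
    have "label_shattered m U G S"
      unfolding label_shattered_def
    proof
      fix y assume y: "y \<in> cart m U"
      define y' where "y' = (if y j \<in> A then y else y(j := a))"
      have "y' \<in> cart m ?Z" using y a j by (auto simp: y'_def PiE_iff extensional_def)
      then obtain s where s: "s \<in> ?S" "\<forall>i<m. f i (s i) = f i (y' i)"
        by (rule label_shatteredD[OF sh])
      then have "G i (s i) = G i (y i)" if "i < m" for i
        using S'[of s] that by (auto simp: G_def y'_def)
      then show "\<exists>s\<in>S. \<forall>i<m. G i (s i) = G i (y i)" using s by blast
    qed
    then obtain w where w: "label_copy m U G S w" using ampleD[OF ample] by blast
    have Gf: "G i x = f i x" if "i < m" "x \<in> ?Z i" for i x
      using that by (auto simp: G_def split: if_splits)
    have wG: "G i (w i (f i x)) = f i x" if "i < m" "x \<in> ?Z i" for i x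
      using label_copyD1[OF w, of i x] that A Gf[OF that] by (auto split: if_splits)
    have sel: "select m w f y \<in> S" if y: "y \<in> cart m ?Z" for y
    proof -
      have "select m w f y = select m w G y"
        using y by (intro select_cong) (auto simp: Gf PiE_iff)
      then show ?thesis using label_copyD2[OF w] ZU[OF y] by simp
    qed
    \<comment> \<open>If the copy left \<open>A\<close>, its point over \<open>z(j := x)\<close>
      would lie outside \<open>A\<close> and have the labels of \<open>z\<close> off
      \<open>j\<close>, which the choice of \<open>z\<close> excludes.\<close>
    have wA: "w j (f j x) \<in> A" if x: "x \<in> A" for x
    proof (rule ccontr)
      assume no: "w j (f j x) \<notin> A"
      have zx: "z(j := x) \<in> cart m ?Z" using z x j by (auto simp: PiE_iff extensional_def)
      have "select m w f (z(j := x)) \<in> S" using sel zx by blast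
      moreover have "F i (select m w f (z(j := x)) i) = F i (z i)" if "i < m" for i
        using wG[OF that, of "z i"] z(1) that no zj by (auto simp: F_def G_def PiE_iff)
      ultimately show False using z(2) by blast
    qed
    have "label_copy m ?Z f ?S w"
      unfolding label_copy_def
    proof (intro conjI allI impI ballI)
      fix i x assume ix: "i < m" "x \<in> ?Z i"
      show "f i (w i (f i x)) = f i x"
        using wG[OF ix] wA ix by (auto simp: G_def split: if_splits)
    next
      fix y assume y: "y \<in> cart m ?Z"
      then have "y j \<in> A" using PiE_mem[OF y, of j] j by simp
      then show "select m w f y \<in> ?S" unfolding S' using sel[OF y] wA j by auto
    qed
    then show ?thesis by blast
  qed
qed

lemma ample_inter_box:
  assumes ample: "ample m U S" and ne: "\<And>i. i < m \<Longrightarrow> Z i \<noteq> {}"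
    and sub: "\<And>i. i < m \<Longrightarrow> Z i \<subseteq> U i"
  shows "ample m Z (S \<inter> cart m Z)"
proof -
  define Y where "Y k i = (if i < k then Z i else U i)" for k i
  have "ample m (Y k) (S \<inter> cart m (Y k))" if "k \<le> m" for k
    using that
  proof (induction k)
    case 0
    have "Y 0 = U" by (auto simp: Y_def)
    then show ?case using ample ample_subset[OF ample] by (simp add: Int_absorb2)
  next
    case (Suc k)
    have Y: "Y (Suc k) = (Y k)(k := Z k)" by (auto simp: Y_def fun_eq_iff less_Suc_eq)
    have "ample m ((Y k)(k := Z k)) (S \<inter> cart m (Y k) \<inter> cart m ((Y k)(k := Z k)))"
      
    proof (rule ample_inter_factor)
      show "ample m (Y k) (S \<inter> cart m (Y k))" using Suc by simp
      show "Y k i \<noteq> {}" if "i < m" for i using ne[OF that] sub[OF that] by (auto simp: Y_def)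
      show "k < m" using Suc.prems by simp
      then show "Z k \<subseteq> Y k k" "Z k \<noteq> {}" using ne sub by (auto simp: Y_def)
    qed
    moreover have "cart m (Y (Suc k)) \<subseteq> cart m (Y k)"
      using sub Suc.prems by (intro PiE_mono) (auto simp: Y_def less_Suc_eq)
    ultimately show ?case unfolding Y by (simp add: Int_assoc Int_absorb1 del: fun_upd_apply)
  qed
  from this[of m] have "ample m (Y m) (S \<inter> cart m (Y m))" by simp
  moreover have "cart m (Y m) = cart m Z" by (intro PiE_cong) (auto simp: Y_def)
  \<comment> \<open>\<open>Y m\<close> and \<open>Z\<close> agree only below \<open>m\<close>, so
    they need not be equal as functions; ampleness looks at nothing else.\<close>
  moreover have "ample m (Y m) T \<longleftrightarrow> ample m Z T" for T
  proof -
    have "gen_partitions m (Y m) = gen_partitions m Z"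
      unfolding gen_partitions_def by (intro PiE_cong) (auto simp: Y_def)
    then show ?thesis using \<open>cart m (Y m) = cart m Z\<close> by (simp add: ample_def)
  qed
  ultimately show ?thesis by simp
qed

section \<open>Geodesics\<close>

text \<open>Each step gives one coordinate its final value. So every vertex lies in the interval of
  the two ends and the number of steps is their distance, without any lists or length
  conditions.\<close>

inductive geodesic :: "nat \<Rightarrow> (nat \<Rightarrow> 'a) set \<Rightarrow> (nat \<Rightarrow> 'a) \<Rightarrow> (nat \<Rightarrow> 'a) \<Rightarrow> bool" for m S where
  geodesic_refl: "u \<in> S \<Longrightarrow> geodesic m S u u"
| geodesic_step: "u \<in> S \<Longrightarrow> i < m \<Longrightarrow> u i \<noteq> v i \<Longrightarrow> geodesic m S (u(i := v i)) v \<Longrightarrow> geodesic m S u v"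

definition geodesically_closed :: "nat \<Rightarrow> (nat \<Rightarrow> 'a) set \<Rightarrow> bool" where
  "geodesically_closed m S \<longleftrightarrow> (\<forall>u\<in>S. \<forall>v\<in>S. geodesic m S u v)"

lemma geodesic_in: "geodesic m S u v \<Longrightarrow> u \<in> S \<and> v \<in> S"
  by (induction rule: geodesic.induct) auto

lemma geodesic_mono: "geodesic m S u v \<Longrightarrow> S \<subseteq> T \<Longrightarrow> geodesic m T u v"
  by (induction rule: geodesic.induct) (auto intro: geodesic.intros)

text \<open>A geodesic changes coordinate \<open>j\<close> just once, and \<open>z\<close> is the
  vertex before that change. The remaining geodesic is recorded because
  \<open>geodesic_extend\<close> attaches a new beginning to it.\<close>

lemma geodesic_cross:
  assumes "geodesic m S u v" "u j \<noteq> v j"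
  obtains z where "z \<in> S" "z j = u j" "z(j := v j) \<in> S" "\<And>i. z i = u i \<or> z i = v i"
    "geodesic m S (z(j := v j)) v"
proof -
  from assms have "\<exists>z\<in>S. z j = u j \<and> z(j := v j) \<in> S \<and> (\<forall>i. z i = u i \<or> z i = v i) \<and> geodesic m S (z(j := v j)) v"
  proof (induction rule: geodesic.induct)
    case (geodesic_refl u)
    then show ?case by simp
  next
    case (geodesic_step u i v)
    show ?case
    proof (cases "i = j")
      case True
      then show ?thesis using geodesic_step.hyps geodesic_in[OF geodesic_step.hyps(4)] by blast
    next
      case False
      with geodesic_step obtain z where z: "z \<in> S" "z j = u j" "z(j := v j) \<in> S"
        "\<forall>k. z k = (u(i := v i)) k \<or> z k = v k" "geodesic m S (z(j := v j)) v" by fastforce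
      have "z k = u k \<or> z k = v k" for k using z(4)[rule_format, of k] by (auto split: if_splits)
      with z show ?thesis by blast
    qed
  qed
  then show thesis using that by blast
qed

lemma geodesic_trans:
  assumes "geodesic m S u t" "geodesic m S t v" "\<And>i. i < m \<Longrightarrow> t i = u i \<or> t i = v i"
  shows "geodesic m S u v"
  using assms
proof (induction rule: geodesic.induct)
  case (geodesic_refl u)
  then show ?case by simp
next
  case (geodesic_step u i t)
  have ti: "t i = v i" using geodesic_step.hyps(2,3) geodesic_step.prems(2)[of i] by auto
  have "geodesic m S (u(i := t i)) v"
    by (rule geodesic_step.IH[OF geodesic_step.prems(1)]) (use geodesic_step.prems(2) in auto)
  then show ?case using geodesic_step.hyps ti by (auto intro: geodesic.geodesic_step)
qed

section \<open>Hamming distance, and geodesics as shortest paths\<close>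

lemma hamming_dist_upd:
  assumes "i < m" "u i \<noteq> v i"
  shows "hamming_dist m u v = Suc (hamming_dist m (u(i := v i)) v)"
proof -
  have "{k. k < m \<and> u k \<noteq> v k} = insert i {k. k < m \<and> (u(i := v i)) k \<noteq> v k}"
    using assms by auto
  then show ?thesis unfolding hamming_dist_def by simp
qed

lemma hamming_dist_triangle: "hamming_dist m u v \<le> hamming_dist m u x + hamming_dist m x v"
proof -
  have "{i. i < m \<and> u i \<noteq> v i} \<subseteq> {i. i < m \<and> u i \<noteq> x i} \<union> {i. i < m \<and> x i \<noteq> v i}" by auto
  then have "hamming_dist m u v \<le> card ({i. i < m \<and> u i \<noteq> x i} \<union> {i. i < m \<and> x i \<noteq> v i})"
    unfolding hamming_dist_def by (intro card_mono) auto
  also have "\<dots> \<le> hamming_dist m u x + hamming_dist m x v"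
    unfolding hamming_dist_def by (rule card_Un_le)
  finally show ?thesis .
qed

lemma hamming_adj_iff:
  "hamming_adj m u v \<longleftrightarrow> (\<exists>i<m. u i \<noteq> v i \<and> (\<forall>k<m. k \<noteq> i \<longrightarrow> u k = v k))"
  unfolding hamming_adj_def Ex1_def by (rule ex_cong1) auto

lemma hamming_adj_upd: "i < m \<Longrightarrow> u i \<noteq> a \<Longrightarrow> hamming_adj m u (u(i := a))"
  unfolding hamming_adj_iff by auto

lemma hamming_adj_dist:
  assumes "hamming_adj m u v"
  shows "hamming_dist m u v = 1"
proof -
  from assms obtain i where "i < m" "u i \<noteq> v i" "\<forall>k<m. k \<noteq> i \<longrightarrow> u k = v k"
    unfolding hamming_adj_iff by (elim exE conjE) (rule that)
  then have "{k. k < m \<and> u k \<noteq> v k} = {i}" by auto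
  then show ?thesis by (simp add: hamming_dist_def)
qed

lemma hamming_adjE:
  assumes "hamming_adj m u v" "u \<in> cart m U" "v \<in> cart m U"
  obtains i where "i < m" "u i \<noteq> v i" "v = u(i := v i)"
proof -
  from assms(1) obtain i where i: "i < m" "u i \<noteq> v i" "\<forall>k<m. k \<noteq> i \<longrightarrow> u k = v k"
    unfolding hamming_adj_iff by (elim exE conjE) (rule that)
  have "v = u(i := v i)"
  proof
    fix k show "v k = (u(i := v i)) k"
    proof (cases "k < m")
      case False
      then show ?thesis using i(1) PiE_arb[OF assms(2), of k] PiE_arb[OF assms(3), of k] by simp
    qed (use i(3) in simp)
  qed
  with i(1,2) show thesis by (rule that)
qed

lemma hamming_dist_eq_0:
  assumes "hamming_dist m u v = 0" "u \<in> cart m U" "v \<in> cart m U"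
  shows "u = v"
  using assms by (intro PiE_ext[of u "{..<m}" U v]) (auto simp: hamming_dist_def)

lemma geodesic_path:
  assumes "geodesic m S u v"
  obtains p where "hamming_path m S u p v" "length p - 1 = hamming_dist m u v"
proof -
  \<comment> \<open>The bound on the distances to \<open>v\<close> yields distinctness:
    \<open>u\<close> is farther from \<open>v\<close> than every vertex of the path that starts
    after the first step.\<close>
  from assms have "\<exists>p. hamming_path m S u p v \<and> length p = Suc (hamming_dist m u v) \<and>
      (\<forall>x\<in>set p. hamming_dist m x v \<le> hamming_dist m u v)"
  proof (induction rule: geodesic.induct)
    case (geodesic_refl u)
    then show ?case by (intro exI[of _ "[u]"]) (auto simp: hamming_path_def hamming_dist_def)
  next
    case (geodesic_step u i v)
    let ?x = "u(i := v i)"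
    from geodesic_step.IH obtain p where p: "hamming_path m S ?x p v" "length p = Suc (hamming_dist m ?x v)"
      "\<forall>y\<in>set p. hamming_dist m y v \<le> hamming_dist m ?x v" by blast
    have d: "hamming_dist m u v = Suc (hamming_dist m ?x v)" using geodesic_step.hyps by (intro hamming_dist_upd) auto
    have "u \<notin> set p" using p(3) d by force
    moreover have "hamming_adj m u ?x" using geodesic_step.hyps by (intro hamming_adj_upd) auto
    ultimately have "hamming_path m S u (u # p) v"
      using p(1) geodesic_step.hyps(1) unfolding hamming_path_def by (cases p) auto
    then show ?case using p d by (intro exI[of _ "u # p"]) auto
  qed
  then show thesis using that by auto
qed

lemma successively_hamming_dist:
  "p \<noteq> [] \<Longrightarrow> successively (hamming_adj m) p \<Longrightarrow> hamming_dist m (hd p) (last p) \<le> length p - 1"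
proof (induction p)
  case (Cons x p)
  show ?case
  proof (cases p)
    case Nil
    then show ?thesis by (simp add: hamming_dist_def)
  next
    case (Cons y q)
    then have "hamming_adj m x y" using Cons.prems by simp
    then have "hamming_dist m x (last p) \<le> 1 + hamming_dist m y (last p)"
      using hamming_dist_triangle[of m x "last p" y] hamming_adj_dist by fastforce
    then show ?thesis using Cons.IH Cons.prems Cons by auto
  qed
qed simp

text \<open>By the triangle inequality each step of such a path must decrease the distance to the
  end, and a step does so only if it gives the changed coordinate its final value.\<close>

lemma path_geodesic:
  assumes "S \<subseteq> cart m U"
  shows "p \<noteq> [] \<Longrightarrow> set p \<subseteq> S \<Longrightarrow> successively (hamming_adj m) p \<Longrightarrow>
    length p - 1 = hamming_dist m (hd p) (last p) \<Longrightarrow> geodesic m S (hd p) (last p)"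
proof (induction p)
  case (Cons x p)
  show ?case
  proof (cases p)
    case Nil
    then show ?thesis using Cons.prems by (auto intro: geodesic_refl)
  next
    case (Cons y q)
    let ?v = "last p"
    have S: "x \<in> S" "y \<in> S" using Cons.prems Cons by auto
    have suc: "successively (hamming_adj m) p" and adj: "hamming_adj m x y" using Cons.prems Cons by auto
    have ylen: "hamming_dist m y ?v \<le> length p - 1" using successively_hamming_dist[OF _ suc] Cons by simp
    have xd: "hamming_dist m x ?v = length p" using Cons.prems Cons by simp
    have yd: "hamming_dist m y ?v = length p - 1"
      using ylen xd hamming_dist_triangle[of m x ?v y] hamming_adj_dist[OF adj] Cons by simp
    have geo: "geodesic m S y ?v" using Cons.IH Cons.prems Cons yd suc by auto
    obtain i where i: "i < m" "x i \<noteq> y i" "y = x(i := y i)" 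
      by (rule hamming_adjE[OF adj subsetD[OF assms S(1)] subsetD[OF assms S(2)]])
    have "y i = ?v i"
    proof (rule ccontr)
      assume ne: "y i \<noteq> ?v i"
      have "{k. k < m \<and> x k \<noteq> ?v k} \<subseteq> {k. k < m \<and> y k \<noteq> ?v k}"
      proof (intro Collect_mono impI conjI; elim conjE)
        fix k assume "k < m" "x k \<noteq> ?v k"
        then show "y k \<noteq> ?v k" using ne fun_cong[OF i(3), of k] by (cases "k = i") auto
      qed
      then have "hamming_dist m x ?v \<le> hamming_dist m y ?v"
        unfolding hamming_dist_def by (intro card_mono) auto
      then show False using xd yd Cons by simp
    qed
    then have "geodesic m S (x(i := ?v i)) ?v" "x i \<noteq> ?v i" using i(2,3) geo by simp_all
    then show ?thesis using geodesic_step[OF S(1) i(1)] Cons by simp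
  qed
qed simp

lemma hamming_isometric_iff:
  assumes "S \<subseteq> cart m U"
  shows "hamming_isometric m S \<longleftrightarrow> geodesically_closed m S"
proof
  assume iso: "hamming_isometric m S"
  show "geodesically_closed m S"
    unfolding geodesically_closed_def
  proof (intro ballI)
    fix u v assume "u \<in> S" "v \<in> S"
    with iso obtain p where "hamming_path m S u p v" "length p - 1 = hamming_dist m u v"
      unfolding hamming_isometric_def by blast
    then show "geodesic m S u v"
      using path_geodesic[OF assms, of p] unfolding hamming_path_def by auto
  qed
next
  assume "geodesically_closed m S"
  then show "hamming_isometric m S"
    unfolding hamming_isometric_def geodesically_closed_def by (blast elim: geodesic_path)
qed

lemma hamming_isometric_connected: "hamming_isometric m S \<Longrightarrow> hamming_connected m S"
  unfolding hamming_isometric_def hamming_connected_def by blast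

text \<open>The source of points of \<open>S\<^sup>e\<close>: for \<open>s j = a\<close> and
  \<open>t j = b\<close>, the point \<open>y\<close> has its twin at \<open>b\<close> in
  \<open>S\<close>. Off \<open>j\<close> it keeps every label that \<open>s\<close> and
  \<open>t\<close> share.\<close>

lemma geodesic_square:
  assumes "geodesically_closed m S" "s \<in> S" "t \<in> S" "s j \<noteq> t j"
  obtains y where "y \<in> S" "y j = s j" "y(j := t j) \<in> S" "\<And>i. y i = s i \<or> y i = t i"
proof -
  have "geodesic m S s t" using assms by (simp add: geodesically_closed_def)
  then show thesis using assms(4) that by (rule geodesic_cross) auto
qed

section \<open>Intervals and isometry\<close>

lemma cart_interval: "x \<in> cart m (interval_factors u v) \<longleftrightarrow> (\<forall>i<m. x i = u i \<or> x i = v i) \<and> x \<in> extensional {..<m}"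
  by (auto simp: PiE_iff interval_factors_def)

lemma cart_intervalI:
  assumes "x \<in> cart m U" "\<And>i. i < m \<Longrightarrow> x i = u i \<or> x i = v i"
  shows "x \<in> cart m (interval_factors u v)"
  unfolding cart_interval using assms by (auto simp: PiE_def)

lemma ample_inter_interval:
  assumes ample: "ample m U S" and uv: "u \<in> S" "v \<in> S"
  shows "ample m (interval_factors u v) (S \<inter> cart m (interval_factors u v))"
proof (rule ample_inter_box[OF ample])
  have "u \<in> cart m U" "v \<in> cart m U" using uv ample_subset[OF ample] by auto
  then show "interval_factors u v i \<subseteq> U i" if "i < m" for i
    using that by (auto simp: interval_factors_def PiE_iff)
qed (simp add: interval_factors_def)

text \<open>If \<open>w\<close> is closest to \<open>u\<close> among the other points of \<open>S\<close> in \<open>[u, v]\<close>, then \<open>S\<close> meets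
  \<open>[u, w]\<close> in \<open>{u, w}\<close> only, which is ample in \<open>[u, w]\<close> only if \<open>u\<close> and \<open>w\<close> are adjacent.\<close>

lemma interval_ample_step:
  assumes SU: "S \<subseteq> cart m U"
    and int: "\<And>u v. u \<in> S \<Longrightarrow> v \<in> S \<Longrightarrow> ample m (interval_factors u v) (S \<inter> cart m (interval_factors u v))"
    and uv: "u \<in> S" "v \<in> S" "u \<noteq> v"
  obtains i where "i < m" "u i \<noteq> v i" "u(i := v i) \<in> S"
proof -
  define T where "T = S \<inter> cart m (interval_factors u v) - {u}"
  have "v \<in> T" using uv SU by (auto simp: T_def intro!: cart_intervalI[of _ m U])
  then obtain w where w: "w \<in> T" and wmin: "\<And>x. x \<in> T \<Longrightarrow> hamming_dist m u w \<le> hamming_dist m u x"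
    using ex_has_least_nat[of "\<lambda>x. x \<in> T" v "hamming_dist m u"] by blast
  have wS: "w \<in> S" "w \<noteq> u" using w by (auto simp: T_def)
  have wi: "w i = u i \<or> w i = v i" if "i < m" for i
    using w that by (auto simp: T_def cart_interval)
  let ?I = "interval_factors u w"
  have two: "S \<inter> cart m ?I \<subseteq> {u, w}"
  proof
    fix x assume x: "x \<in> S \<inter> cart m ?I"
    show "x \<in> {u, w}"
    proof (rule ccontr)
      assume no: "x \<notin> {u, w}"
      have "x \<in> cart m (interval_factors u v)"
        by (rule cart_intervalI[of _ _ ?I]) (use x wi in \<open>auto simp: cart_interval\<close>, metis)
      then have "x \<in> T" using x no by (auto simp: T_def)
      then have le: "hamming_dist m u w \<le> hamming_dist m u x" by (rule wmin)
      have xw: "x i = u i \<or> x i = w i" if "i < m" for i using x that by (auto simp: cart_interval)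
      have "{i. i < m \<and> u i \<noteq> x i} \<subseteq> {i. i < m \<and> u i \<noteq> w i}"
        using xw by (intro Collect_mono) metis
      then have "{i. i < m \<and> u i \<noteq> x i} = {i. i < m \<and> u i \<noteq> w i}"
        using le unfolding hamming_dist_def by (intro card_seteq) auto
      then have "i < m \<and> u i \<noteq> x i \<longleftrightarrow> i < m \<and> u i \<noteq> w i" for i by (simp add: set_eq_iff)
      then have "x i = w i" if "i < m" for i using xw[OF that] that by metis
      then have "x = w" using x wS SU by (intro PiE_ext[of x "{..<m}" U w]) auto
      then show False using no by simp
    qed
  qed
  have uw: "u \<in> cart m ?I" "w \<in> cart m ?I" using uv wS SU by (auto intro!: cart_intervalI[of _ m U])
  have "\<exists>j<m. u j \<noteq> w j"
  proof (rule ccontr)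
    assume "\<not> ?thesis"
    then have "u = w" using wS uv(1) SU by (intro PiE_ext[of u "{..<m}" U w]) auto
    then show False using wS by simp
  qed
  then obtain j where j: "j < m" "u j \<noteq> w j" by blast
  \<comment> \<open>There are only two patterns, told apart by coordinate \<open>j\<close> and
    realised by \<open>u\<close> and \<open>w\<close>. A copy consists of two points of
    \<open>{u, w}\<close> that differ in \<open>j\<close> alone.\<close>
  define f where "f i x = (i \<noteq> j \<or> x = u j)" for i x
  have "label_shattered m ?I f (S \<inter> cart m ?I)"
    unfolding label_shattered_def
  proof
    fix z assume z: "z \<in> cart m ?I"
    then have "z j = u j \<or> z j = w j" using j by (auto simp: cart_interval)
    then have "\<exists>s\<in>{u, w}. \<forall>i<m. f i (s i) = f i (z i)" by (auto simp: f_def)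
    then show "\<exists>s\<in>S \<inter> cart m ?I. \<forall>i<m. f i (s i) = f i (z i)" using uv(1) wS(1) uw by blast
  qed
  then obtain g where g: "label_copy m ?I f (S \<inter> cart m ?I) g"
    using ampleD[OF int[OF uv(1) wS(1)]] by blast
  have fg: "f j (g j (f j x)) = f j x" if "x = u j \<or> x = w j" for x
    using label_copyD1[OF g j(1), of x] that by (auto simp: interval_factors_def)
  have "select m g f u \<in> {u, w}" "select m g f w \<in> {u, w}"
    by (rule subsetD[OF two label_copyD2[OF g uw(1)]], rule subsetD[OF two label_copyD2[OF g uw(2)]])
  moreover have "select m g f u \<noteq> w"
  proof
    assume "select m g f u = w"
    from fun_cong[OF this, of j] have "g j (f j (u j)) = w j" using j(1) by simp
    then show False using fg[of "u j"] j by (auto simp: f_def)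
  qed
  moreover have "select m g f w \<noteq> u"
  proof
    assume "select m g f w = u"
    from fun_cong[OF this, of j] have "g j (f j (w j)) = u j" using j(1) by simp
    then show False using fg[of "w j"] j by (auto simp: f_def)
  qed
  ultimately have sel: "select m g f u = u" "select m g f w = w" by auto
  have eq: "u i = w i" if "i < m" "i \<noteq> j" for i
    using select_apply[OF that(1), of g f u] select_apply[OF that(1), of g f w] sel that by (simp add: f_def)
  have "u(j := v j) = w"
  proof
    fix i show "(u(j := v j)) i = w i"
    proof (cases "i < m")
      case True
      then show ?thesis using eq[of i] wi[OF j(1)] j(2) by auto
    next
      case False
      have "u \<in> cart m U" "w \<in> cart m U" using uv(1) wS(1) SU by auto
      then show ?thesis using False j(1) PiE_arb[of u _ U i] PiE_arb[of w _ U i] by simp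
    qed
  qed
  then show thesis using that[OF j(1)] wi[OF j(1)] j(2) wS(1) by simp
qed

lemma interval_ample_geodesic:
  assumes SU: "S \<subseteq> cart m U"
    and int: "\<And>u v. u \<in> S \<Longrightarrow> v \<in> S \<Longrightarrow> ample m (interval_factors u v) (S \<inter> cart m (interval_factors u v))"
  shows "geodesically_closed m S"
proof -
  have "geodesic m S u v" if "u \<in> S" "v \<in> S" for u v
    using that
  proof (induction "hamming_dist m u v" arbitrary: u)
    case 0
    then have "u = v" using hamming_dist_eq_0[of m u v U] SU by auto
    then show ?case using 0 by (auto intro: geodesic_refl)
  next
    case (Suc n)
    then have "u \<noteq> v" by (auto simp: hamming_dist_def)
    then obtain i where i: "i < m" "u i \<noteq> v i" "u(i := v i) \<in> S"
      using interval_ample_step[OF SU int Suc.prems] by blast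
    then have "n = hamming_dist m (u(i := v i)) v" using hamming_dist_upd[of i m u v] Suc by simp
    then show ?case using Suc i by (blast intro: geodesic_step)
  qed
  then show ?thesis by (simp add: geodesically_closed_def)
qed

lemma ample_geodesically_closed: "ample m U S \<Longrightarrow> geodesically_closed m S"
  by (rule interval_ample_geodesic[OF ample_subset ample_inter_interval])

section \<open>Merging two points of a factor\<close>

abbreviation agree_off :: "nat \<Rightarrow> nat \<Rightarrow> (nat \<Rightarrow> 'a \<Rightarrow> 'k) \<Rightarrow> (nat \<Rightarrow> 'a) \<Rightarrow> (nat \<Rightarrow> 'a) \<Rightarrow> bool" where
  "agree_off m j f s z \<equiv> \<forall>i<m. i \<noteq> j \<longrightarrow> f i (s i) = f i (z i)"

text \<open>The elementary minor that merges \<open>a\<close> and \<open>b\<close> in factor \<open>j\<close> is represented by deleting \<open>b\<close>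
  from that factor, with \<open>a\<close> standing for the block \<open>{a, b}\<close>; then \<open>lower\<close> is \<open>S\<^sup>e\<close> and
  \<open>upper\<close> is \<open>S\<^sub>e\<close>. This keeps all products over one type, as an induction requires.\<close>

definition lower :: "nat \<Rightarrow> 'a \<Rightarrow> 'a \<Rightarrow> (nat \<Rightarrow> 'a) set \<Rightarrow> (nat \<Rightarrow> 'a) set" where
  "lower j a b S = {x \<in> S. x j \<noteq> b \<and> (x j = a \<longrightarrow> x(j := b) \<in> S)}"

definition upper :: "nat \<Rightarrow> 'a \<Rightarrow> 'a \<Rightarrow> (nat \<Rightarrow> 'a) set \<Rightarrow> (nat \<Rightarrow> 'a) set" where
  "upper j a b S = (\<lambda>x. if x j = b then x(j := a) else x) ` S"

lemma lower_subset: "lower j a b S \<subseteq> S"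
  by (auto simp: lower_def)

lemma cart_remove_iff:
  "j < m \<Longrightarrow> z \<in> cart m (U(j := U j - {b})) \<longleftrightarrow> z \<in> cart m U \<and> z j \<noteq> b"
  by (auto simp: PiE_iff)

lemma lower_cart: "j < m \<Longrightarrow> S \<subseteq> cart m U \<Longrightarrow> lower j a b S \<subseteq> cart m (U(j := U j - {b}))"
  unfolding lower_def using cart_remove_iff[of j m _ U b] by blast

lemma upper_cart:
  assumes "j < m" "S \<subseteq> cart m U" "a \<in> U j" "a \<noteq> b"
  shows "upper j a b S \<subseteq> cart m (U(j := U j - {b}))"
proof
  fix y assume "y \<in> upper j a b S"
  then obtain x where x: "x \<in> S" "y = (if x j = b then x(j := a) else x)" by (auto simp: upper_def)
  have "x \<in> cart m U" using x(1) assms by blast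
  then have "y \<in> cart m U" using cart_upd[of x m U j a] assms x(2) by simp
  moreover have "y j \<noteq> b" using x(2) assms by simp
  ultimately show "y \<in> cart m (U(j := U j - {b}))" using cart_remove_iff[OF assms(1), where U = U and b = b] by blast
qed

section \<open>Elementary minors of an ample set\<close>

lemma ample_upper:
  assumes ample: "ample m U S" and ne: "\<And>i. i < m \<Longrightarrow> U i \<noteq> {}"
    and j: "j < m" and ab: "a \<in> U j" "b \<in> U j" "a \<noteq> b"
  shows "ample m (U(j := U j - {b})) (upper j a b S)" (is "ample m ?V _")
proof (rule ampleI)
  have SU: "S \<subseteq> cart m U" using ample by (rule ample_subset)
  show "upper j a b S \<subseteq> cart m ?V" using j SU ab by (intro upper_cart)
  show "?V i \<noteq> {}" if "i < m" for i using ne[OF that] ab by auto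
  fix f :: "nat \<Rightarrow> 'a \<Rightarrow> 'a set"
  assume sh: "label_shattered m ?V f (upper j a b S)"
  define F where "F i x = f i (if i = j \<and> x = b then a else x)" for i x
  have "label_shattered m U F S"
    unfolding label_shattered_def
  proof
    fix z assume z: "z \<in> cart m U"
    define z' where "z' = (if z j = b then z(j := a) else z)"
    have "z' \<in> cart m U" "z' j \<noteq> b" using z cart_upd[OF z j ab(1)] ab by (simp_all add: z'_def)
    then have "z' \<in> cart m ?V" using cart_remove_iff[OF j, where U = U and b = b] by blast
    then obtain t where t: "t \<in> upper j a b S" "\<forall>i<m. f i (t i) = f i (z' i)"
      by (rule label_shatteredD[OF sh])
    then obtain x where x: "x \<in> S" "t = (if x j = b then x(j := a) else x)" by (auto simp: upper_def)
    have "F i (x i) = F i (z i)" if "i < m" for i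
      using t(2)[rule_format, OF that] by (cases "i = j") (auto simp: F_def x(2) z'_def split: if_splits)
    then show "\<exists>s\<in>S. \<forall>i<m. F i (s i) = F i (z i)" using x(1) by blast
  qed
  then obtain w where w: "label_copy m U F S w" using ampleD[OF ample] by blast
  define w' where "w' i k = (if i = j \<and> w i k = b then a else w i k)" for i k
  have Ff: "F i x = f i x" if "x \<in> ?V i" for i x using that by (auto simp: F_def split: if_splits)
  have "label_copy m ?V f (upper j a b S) w'"
    unfolding label_copy_def
  proof (intro conjI allI impI ballI)
    fix i x assume ix: "i < m" "x \<in> ?V i"
    then have "x \<in> U i" by (auto split: if_splits)
    then have "F i (w i (f i x)) = f i x" using label_copyD1[OF w ix(1), of x] Ff[OF ix(2)] by simp
    then show "f i (w' i (f i x)) = f i x" by (simp add: F_def w'_def)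
  next
    fix z assume z: "z \<in> cart m ?V"
    then have zU: "z \<in> cart m U" using cart_remove_iff[OF j, where U = U and b = b] by blast
    have Fz: "F i (z i) = f i (z i)" if "i < m" for i using PiE_mem[OF z, of i] that by (intro Ff) simp
    let ?s = "select m w F z"
    have "select m w' f z = (if ?s j = b then ?s(j := a) else ?s)"
    proof
      fix i show "select m w' f z i = (if ?s j = b then ?s(j := a) else ?s) i"
        using Fz[of i] j by (cases "i < m"; cases "i = j") (auto simp: select_def w'_def)
    qed
    then show "select m w' f z \<in> upper j a b S"
      using label_copyD2[OF w zU] unfolding upper_def by blast
  qed
  then show "\<exists>w. label_copy m ?V f (upper j a b S) w" by blast
qed

lemma ample_lower:
  assumes ample: "ample m U S" and ne: "\<And>i. i < m \<Longrightarrow> U i \<noteq> {}"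
    and j: "j < m" and ab: "a \<in> U j" "b \<in> U j" "a \<noteq> b"
  shows "ample m (U(j := U j - {b})) (lower j a b S)" (is "ample m ?V ?L")
proof (rule ampleI)
  have SU: "S \<subseteq> cart m U" using ample by (rule ample_subset)
  show "?L \<subseteq> cart m ?V" using j SU by (rule lower_cart)
  show "?V i \<noteq> {}" if "i < m" for i using ne[OF that] ab by auto
  fix f :: "nat \<Rightarrow> 'a \<Rightarrow> 'a set"
  assume sh: "label_shattered m ?V f ?L"
  have V: "z \<in> cart m ?V \<longleftrightarrow> z \<in> cart m U \<and> z j \<noteq> b" for z by (rule cart_remove_iff[OF j])
  have Vmem: "x \<in> U i \<and> (i = j \<longrightarrow> x \<noteq> b)" if "x \<in> ?V i" for i x
    using that by (auto split: if_splits)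
  \<comment> \<open>Replacing \<open>b\<close> by \<open>a\<close> turns a pattern of
    \<open>U\<close> into one of \<open>?V\<close>, which \<open>lower\<close> meets by
    assumption.\<close>
  have move: "\<exists>s\<in>?L. \<forall>i<m. f i (s i) = f i (if i = j \<and> z i = b then a else z i)"
    if z: "z \<in> cart m U" for z
  proof -
    define z' where "z' = (if z j = b then z(j := a) else z)"
    have "z' \<in> cart m ?V" using z cart_upd[OF z j ab(1)] ab V by (simp add: z'_def)
    then obtain s where "s \<in> ?L" "\<forall>i<m. f i (s i) = f i (z' i)"
      by (rule label_shatteredD[OF sh])
    then show ?thesis by (intro bexI[of _ s]) (auto simp: z'_def)
  qed
  have inL: "s \<in> ?L \<longleftrightarrow> s \<in> S \<and> s j \<noteq> b \<and> (s j = a \<longrightarrow> s(j := b) \<in> S)" for s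
    by (simp add: lower_def)
  consider (b) "\<forall>z\<in>cart m U. \<exists>s\<in>S. s j = b \<and> agree_off m j f s z"
    | (a) "\<forall>z\<in>cart m U. \<exists>s\<in>S. s j = a \<and> agree_off m j f s z"
    | (none) z1 z2 where "z1 \<in> cart m U" "\<forall>s\<in>S. s j = b \<longrightarrow> \<not> agree_off m j f s z1"
        "z2 \<in> cart m U" "\<forall>s\<in>S. s j = a \<longrightarrow> \<not> agree_off m j f s z2" by metis
  then show "\<exists>w. label_copy m ?V f ?L w"
  proof cases
    case b
    \<comment> \<open>\<open>b\<close> is alone in the block \<open>None\<close>, so this column of
      the copy is at \<open>b\<close>. Wherever another label chooses \<open>a\<close>, it contains
      the twin.\<close>
    define F where "F i x = (if i = j \<and> x = b then None else Some (f i x))" for i x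
    have "label_shattered m U F S"
      unfolding label_shattered_def
    proof
      fix z assume z: "z \<in> cart m U"
      show "\<exists>s\<in>S. \<forall>i<m. F i (s i) = F i (z i)"
      proof (cases "z j = b")
        case True
        from b z obtain s where "s \<in> S" "s j = b" "agree_off m j f s z" by blast
        then show ?thesis using True by (intro bexI[of _ s]) (auto simp: F_def)
      next
        case False
        from move[OF z] obtain s where "s \<in> ?L" "\<forall>i<m. f i (s i) = f i (if i = j \<and> z i = b then a else z i)"
          by blast
        then show ?thesis using False inL[of s] by (intro bexI[of _ s]) (auto simp: F_def)
      qed
    qed
    then obtain w where w: "label_copy m U F S w" using ampleD[OF ample] by blast
    define w' where "w' i k = w i (Some k)" for i k
    have lab: "f i (w' i (f i x)) = f i x \<and> (i = j \<longrightarrow> w' i (f i x) \<noteq> b)" if "i < m" "x \<in> ?V i" for i x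
    proof -
      have "F i x = Some (f i x)" using Vmem[OF that(2)] by (simp add: F_def)
      then have "F i (w' i (f i x)) = Some (f i x)"
        using label_copyD1[OF w that(1), of x] Vmem[OF that(2)] by (simp add: w'_def)
      then show ?thesis by (simp add: F_def split: if_splits)
    qed
    have wb: "w j None = b" using label_copyD1[OF w j ab(2)] by (simp add: F_def split: if_splits)
    have "label_copy m ?V f ?L w'"
      unfolding label_copy_def
    proof (intro conjI allI impI ballI)
      fix i x assume "i < m" "x \<in> ?V i"
      then show "f i (w' i (f i x)) = f i x" using lab by blast
    next
      fix z assume zV: "z \<in> cart m ?V"
      then have z: "z \<in> cart m U" "z j \<noteq> b" using V by auto
      have eq: "select m w' f z = select m w F z"
        using z(2) by (intro select_cong) (auto simp: F_def w'_def)
      have 1: "select m w' f z \<in> S" using label_copyD2[OF w z(1)] eq by simp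
      have 2: "(select m w' f z)(j := b) = select m w F (z(j := b))"
        using j wb by (intro select_upd) (auto simp: F_def w'_def)
      have 3: "select m w F (z(j := b)) \<in> S" using label_copyD2[OF w cart_upd[OF z(1) j ab(2)]] .
      have 4: "select m w' f z j \<noteq> b" using lab[OF j PiE_mem[OF zV]] j by simp
      show "select m w' f z \<in> ?L" unfolding inL using 1 2 3 4 by simp
    qed
    then show ?thesis by blast
  next
    case a
    \<comment> \<open>Now \<open>a\<close> is alone, and \<open>b\<close> takes over its old label.
      The labels \<open>Some k\<close> never choose \<open>a\<close>; where one chooses
      \<open>b\<close>, the value is changed to \<open>a\<close>, and the column of
      \<open>None\<close> shows that the new point is in \<open>S\<close>.\<close>
    define F where "F i x = (if i = j \<and> x = a then None else Some (f i (if i = j \<and> x = b then a else x)))" for i x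
    have "label_shattered m U F S"
      unfolding label_shattered_def
    proof
      fix z assume z: "z \<in> cart m U"
      show "\<exists>s\<in>S. \<forall>i<m. F i (s i) = F i (z i)"
      proof (cases "z j = a")
        case True
        from a z obtain s where "s \<in> S" "s j = a" "agree_off m j f s z" by blast
        then show ?thesis using True by (intro bexI[of _ s]) (auto simp: F_def)
      next
        case False
        from move[OF z] obtain s where s: "s \<in> ?L" "\<forall>i<m. f i (s i) = f i (if i = j \<and> z i = b then a else z i)"
          by blast
        \<comment> \<open>A point of \<open>lower\<close> at \<open>a\<close> has the label
          \<open>None\<close>; its twin at \<open>b\<close> has the label that is wanted.\<close>
        define t where "t = (if s j = a then s(j := b) else s)"
        have "t \<in> S" using s(1) inL[of s] by (simp add: t_def)
        moreover have "F i (t i) = F i (z i)" if "i < m" for i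
        proof (cases "i = j")
          case True
          then show ?thesis using False s inL[of s] ab(3) j by (auto simp: F_def t_def)
        next
          case i: False
          then show ?thesis using s(2) that by (simp add: F_def t_def)
        qed
        ultimately show ?thesis by blast
      qed
    qed
    then obtain w where w: "label_copy m U F S w" using ampleD[OF ample] by blast
    define w' where "w' i k = (if i = j \<and> w i (Some k) = b then a else w i (Some k))" for i k
    have lab: "F i (w i (Some (f i x))) = Some (f i x)" if "i < m" "x \<in> ?V i" for i x
    proof -
      define y where "y = (if i = j \<and> x = a then b else x)"
      have "y \<in> U i" using Vmem[OF that(2)] ab by (simp add: y_def)
      moreover have "F i y = Some (f i x)" using Vmem[OF that(2)] ab by (auto simp: F_def y_def)
      ultimately show ?thesis using label_copyD1[OF w that(1), of y] by simp
    qed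
    have wa: "w j None = a" using label_copyD1[OF w j ab(1)] by (simp add: F_def split: if_splits)
    have "label_copy m ?V f ?L w'"
      unfolding label_copy_def
    proof (intro conjI allI impI ballI)
      fix i x assume "i < m" "x \<in> ?V i"
      then show "f i (w' i (f i x)) = f i x" using lab[of i x] by (simp add: F_def w'_def split: if_splits)
    next
      fix z assume zV: "z \<in> cart m ?V"
      then have z: "z \<in> cart m U" "z j \<noteq> b" using V by auto
      define z' where "z' = (if z j = a then z(j := b) else z)"
      have z': "z' \<in> cart m U" using z(1) cart_upd[OF z(1) j ab(2)] by (simp add: z'_def)
      define s where "s = select m w F z'"
      have sS: "s \<in> S" using label_copyD2[OF w z'] by (simp add: s_def)
      have si: "s i = w i (Some (f i (z i)))" if "i < m" for i
        using that z(2) ab by (simp add: s_def F_def z'_def)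
      have sj: "s j \<noteq> a" using lab[OF j PiE_mem[OF zV]] j si[OF j] by (auto simp: F_def split: if_splits)
      have sa: "s(j := a) = select m w F (z(j := a))"
      proof
        fix i show "(s(j := a)) i = select m w F (z(j := a)) i"
          using j wa si[of i] by (cases "i < m") (auto simp: F_def s_def select_def z'_def)
      qed
      have saS: "s(j := a) \<in> S" unfolding sa by (rule label_copyD2[OF w cart_upd[OF z(1) j ab(1)]])
      have "select m w' f z = (if s j = b then s(j := a) else s)"
      proof
        fix i show "select m w' f z i = (if s j = b then s(j := a) else s) i"
        proof (cases "i < m")
          case True
          then show ?thesis using si[OF True] by (cases "i = j") (auto simp: w'_def)
        next
          case False
          then show ?thesis using j by (auto simp: select_def s_def)
        qed
      qed
      moreover have "s(j := a) \<in> ?L" if "s j = b"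
      proof -
        have "(s(j := a))(j := b) = s" using that by (simp add: fun_eq_iff)
        then show ?thesis unfolding inL using saS sS ab(3) by simp
      qed
      moreover have "s \<in> ?L" if "s j \<noteq> b" unfolding inL using sS sj that by simp
      ultimately show "select m w' f z \<in> ?L" by simp
    qed
    then show ?thesis by blast
  next
    case none
    define F where "F i x = f i (if i = j \<and> x = b then a else x)" for i x
    have "label_shattered m U F S"
      unfolding label_shattered_def
    proof
      fix z assume z: "z \<in> cart m U"
      from move[OF z] obtain s where "s \<in> ?L" "\<forall>i<m. f i (s i) = f i (if i = j \<and> z i = b then a else z i)"
        by blast
      then show "\<exists>s\<in>S. \<forall>i<m. F i (s i) = F i (z i)"
        using inL[of s] by (intro bexI[of _ s]) (auto simp: F_def)
    qed
    then obtain w where w: "label_copy m U F S w" using ampleD[OF ample] by blast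
    have Ff: "F i x = f i x" if "x \<in> ?V i" for i x using Vmem[OF that] by (auto simp: F_def)
    have FW: "F i (w i (f i x)) = f i x" if "i < m" "x \<in> ?V i" for i x
      using label_copyD1[OF w that(1), of x] Vmem[OF that(2)] Ff[OF that(2)] by simp
    \<comment> \<open>A value \<open>c\<close> chosen by the copy would occur in \<open>S\<close>
      over every pattern of the other coordinates. So \<open>z1\<close> excludes \<open>b\<close>
      and \<open>z2\<close> excludes \<open>a\<close>.\<close>
    have miss: "w j (f j x) \<noteq> c"
      if z: "z \<in> cart m U" "\<forall>s\<in>S. s j = c \<longrightarrow> \<not> agree_off m j f s z" and x: "x \<in> ?V j" for z c x
    proof
      assume c: "w j (f j x) = c"
      have xU: "x \<in> U j" using x by simp
      let ?s = "select m w F (z(j := x))"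
      have "?s \<in> S" by (rule label_copyD2[OF w cart_upd[OF z(1) j xU]])
      moreover have "?s j = c" using c Ff[OF x] j by simp
      moreover have "agree_off m j f ?s z"
      proof (intro allI impI)
        fix i assume i: "i < m" "i \<noteq> j"
        then show "f i (?s i) = f i (z i)"
          using label_copyD1[OF w i(1) PiE_mem[OF z(1)]] by (simp add: F_def)
      qed
      ultimately show False using z(2) by blast
    qed
    have "label_copy m ?V f ?L w"
      unfolding label_copy_def
    proof (intro conjI allI impI ballI)
      fix i x assume ix: "i < m" "x \<in> ?V i"
      have "\<not> (i = j \<and> w i (f i x) = b)" using miss[OF none(1,2), of x] ix by auto
      then have "F i (w i (f i x)) = f i (w i (f i x))" unfolding F_def by (simp only: if_False)
      with FW[OF ix] show "f i (w i (f i x)) = f i x" by (rule back_subst[of "\<lambda>t. t = f i x"])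
    next
      fix z assume zV: "z \<in> cart m ?V"
      then have z: "z \<in> cart m U" "z j \<noteq> b" using V by auto
      have "select m w f z = select m w F z"
        using Ff[OF PiE_mem[OF zV]] by (intro select_cong) simp
      then have "select m w f z \<in> S" using label_copyD2[OF w z(1)] by simp
      moreover have zj: "z j \<in> ?V j" using PiE_mem[OF zV] j by blast
      moreover have "select m w f z j \<noteq> b" "select m w f z j \<noteq> a"
        using miss[OF none(1,2) zj] miss[OF none(3,4) zj] j by simp_all
      ultimately show "select m w f z \<in> ?L" unfolding inL by simp
    qed
    then show ?thesis by blast
  qed
qed

section \<open>Complements of ample sets\<close>

lemma hamming_dist_closer:
  assumes x: "\<And>i. i < m \<Longrightarrow> x i = u i \<or> x i = v i"
    and uv: "u \<in> cart m U" "x \<in> cart m U" "x \<noteq> u"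
  shows "hamming_dist m x v < hamming_dist m u v"
proof -
  obtain i where i: "i < m" "x i \<noteq> u i"
  proof (rule ccontr)
    assume "\<not> thesis"
    then have "x = u" using that uv by (intro PiE_ext[of x "{..<m}" U u]) auto
    then show False using uv(3) by simp
  qed
  have "{i. i < m \<and> x i \<noteq> v i} \<subseteq> {i. i < m \<and> u i \<noteq> v i}"
  proof (intro Collect_mono impI conjI; elim conjE)
    fix k assume "k < m" "x k \<noteq> v k"
    then show "u k \<noteq> v k" using x[of k] by auto
  qed
  moreover have "i \<in> {i. i < m \<and> u i \<noteq> v i}" "i \<notin> {i. i < m \<and> x i \<noteq> v i}"
    using i x[OF i(1)] by auto
  ultimately have "{i. i < m \<and> x i \<noteq> v i} \<subset> {i. i < m \<and> u i \<noteq> v i}" by blast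
  then show ?thesis unfolding hamming_dist_def by (intro psubset_card_mono) auto
qed

lemma hamming_dist_commute: "hamming_dist m u v = hamming_dist m v u"
  unfolding hamming_dist_def by (intro arg_cong[of _ _ card]) auto

text \<open>A closest pair \<open>x \<in> N1\<close>, \<open>y \<in> N2\<close> would leave exactly the interval \<open>[x, y]\<close> minus its
  two antipodal points inside \<open>E\<close>, and such a set is not ample.\<close>

lemma ample_complement_connected:
  assumes ample: "ample m Z E"
    and compl: "cart m Z - E = N1 \<union> N2" and disj: "N1 \<inter> N2 = {}"
    and noedge: "\<And>x i c. x \<in> N1 \<Longrightarrow> i < m \<Longrightarrow> x(i := c) \<notin> N2"
  shows "N1 = {} \<or> N2 = {}"
proof (rule ccontr)
  assume "\<not> ?thesis"
  then obtain p0 where "p0 \<in> N1 \<times> N2" by blast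
  from ex_has_least_nat[of "\<lambda>p. p \<in> N1 \<times> N2", OF this, of "\<lambda>p. hamming_dist m (fst p) (snd p)"]
  obtain p where p: "p \<in> N1 \<times> N2"
    "\<forall>q. q \<in> N1 \<times> N2 \<longrightarrow> hamming_dist m (fst p) (snd p) \<le> hamming_dist m (fst q) (snd q)" by (elim exE conjE) (rule that)
  define u v where "u = fst p" and "v = snd p"
  have u: "u \<in> N1" and v: "v \<in> N2" using p(1) by (auto simp: u_def v_def)
  have least: "hamming_dist m u v \<le> hamming_dist m x y" if "x \<in> N1" "y \<in> N2" for x y
    using p(2)[rule_format, of "(x, y)"] that by (simp add: u_def v_def)
  have uZ: "u \<in> cart m Z" "u \<notin> E" and vZ: "v \<in> cart m Z" "v \<notin> E" using u v compl by blast+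
  let ?I = "interval_factors u v"
  have IZ: "cart m ?I \<subseteq> cart m Z"
    using PiE_mem[OF uZ(1)] PiE_mem[OF vZ(1)] by (intro PiE_mono) (auto simp: interval_factors_def)
  have amp: "ample m ?I (E \<inter> cart m ?I)"
    using PiE_mem[OF uZ(1)] PiE_mem[OF vZ(1)]
    by (intro ample_inter_box[OF ample]) (auto simp: interval_factors_def)
  have inE: "x \<in> E" if x: "x \<in> cart m ?I" "x \<noteq> u" "x \<noteq> v" for x
  proof (rule ccontr)
    assume "x \<notin> E"
    have xZ: "x \<in> cart m Z" using x(1) IZ by blast
    have xi: "x i = u i \<or> x i = v i" if "i < m" for i using x(1) that by (simp add: cart_interval)
    from \<open>x \<notin> E\<close> xZ compl have "x \<in> N1 \<or> x \<in> N2" by blast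
    then show False
    proof
      assume "x \<in> N1"
      then have "hamming_dist m u v \<le> hamming_dist m x v" using v by (rule least)
      with hamming_dist_closer[OF xi uZ(1) xZ x(2)] show False by simp
    next
      assume "x \<in> N2"
      with u have "hamming_dist m u v \<le> hamming_dist m u x" by (rule least)
      moreover have "hamming_dist m x u < hamming_dist m v u"
        using xi by (intro hamming_dist_closer[OF _ vZ(1) xZ x(3)]) blast
      ultimately show False using hamming_dist_commute[of m u] by simp
    qed
  qed
  have "\<exists>j<m. u j \<noteq> v j"
  proof (rule ccontr)
    assume "\<not> ?thesis"
    then have "u = v" using uZ vZ by (intro PiE_ext[of u "{..<m}" Z v]) auto
    then show False using u v disj by blast
  qed
  then obtain j where j: "j < m" "u j \<noteq> v j" by blast
  have uvI: "u \<in> cart m ?I" "v \<in> cart m ?I" using uZ vZ by (auto intro!: cart_intervalI[of _ m Z])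
  \<comment> \<open>Factor \<open>j\<close> is one block and all other blocks are singletons, so a
    pattern is an edge of the interval in direction \<open>j\<close>. Such an edge misses
    \<open>E\<close> only if it joins \<open>u\<close> to \<open>v\<close>, which
    \<open>noedge\<close> forbids. A copy has a constant \<open>j\<close>-coordinate, hence contains
    \<open>u\<close> or \<open>v\<close>, although neither is in \<open>E\<close>.\<close>
  define f where "f i x = (i = j \<or> x = u i)" for i x
  have "label_shattered m ?I f (E \<inter> cart m ?I)"
    unfolding label_shattered_def
  proof
    fix z assume z: "z \<in> cart m ?I"
    have I: "z(j := u j) \<in> cart m ?I" "z(j := v j) \<in> cart m ?I"
      by (rule cart_upd[OF z j(1)]; simp add: interval_factors_def)+
    have "z(j := u j) \<in> E \<or> z(j := v j) \<in> E"
    proof (rule ccontr)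
      assume no: "\<not> ?thesis"
      then have "z(j := u j) = u \<or> z(j := u j) = v" using inE[OF I(1)] by blast
      moreover have "z(j := u j) \<noteq> v" using j by (auto simp: fun_eq_iff)
      ultimately have 1: "z(j := u j) = u" by blast
      have "z(j := v j) = u \<or> z(j := v j) = v" using no inE[OF I(2)] by blast
      moreover have "z(j := v j) \<noteq> u" using j by (auto simp: fun_eq_iff)
      ultimately have "z(j := v j) = v" by blast
      then have "u(j := v j) = v" using 1 by (metis fun_upd_upd)
      then show False using noedge[OF u j(1), of "v j"] v by simp
    qed
    then show "\<exists>s\<in>E \<inter> cart m ?I. \<forall>i<m. f i (s i) = f i (z i)"
    proof
      assume "z(j := u j) \<in> E"
      then show ?thesis using I by (intro bexI[of _ "z(j := u j)"]) (auto simp: f_def)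
    next
      assume "z(j := v j) \<in> E"
      then show ?thesis using I by (intro bexI[of _ "z(j := v j)"]) (auto simp: f_def)
    qed
  qed
  then obtain w where w: "label_copy m ?I f (E \<inter> cart m ?I) w" using ampleD[OF amp] by blast
  let ?s = "select m w f u" and ?t = "select m w f v"
  have s: "?s \<in> E" "?s \<in> cart m ?I" using label_copyD2[OF w uvI(1)] by auto
  have t: "?t \<in> E" "?t \<in> cart m ?I" using label_copyD2[OF w uvI(2)] by auto
  have si: "?s i = u i" if i: "i < m" "i \<noteq> j" for i
  proof -
    have "f i (w i (f i (u i)))"
      using label_copyD1[OF w i(1), of "u i"] i by (simp add: interval_factors_def f_def)
    then show ?thesis using i by (simp add: f_def)
  qed
  have ti: "?t i = v i" if i: "i < m" "i \<noteq> j" for i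
  proof -
    have "f i (?t i) = f i (v i)"
      using label_copyD1[OF w i(1), of "v i"] i by (simp add: interval_factors_def)
    then have "(?t i = u i) = (v i = u i)" using i(2) by (simp only: f_def simp_thms)
    moreover have "?t i = u i \<or> ?t i = v i" using t(2) i(1) by (simp only: cart_interval)
    ultimately show ?thesis by metis
  qed
  have "?s j = ?t j" using j by (simp add: f_def)
  moreover have "?s j = u j \<or> ?s j = v j" using s(2) j(1) by (simp only: cart_interval)
  ultimately consider "?s j = u j" | "?t j = v j" by metis
  then show False
  proof cases
    case 1
    then have "?s i = u i" if "i < m" for i using si[OF that] by (cases "i = j") auto
    then have "?s = u" using s(2) uvI(1) by (intro PiE_ext[of ?s "{..<m}" ?I u]) auto
    then show False using s(1) uZ(2) by simp
  next
    case 2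
    then have "?t i = v i" if "i < m" for i using ti[OF that] by (cases "i = j") auto
    then have "?t = v" using t(2) uvI(2) by (intro PiE_ext[of ?t "{..<m}" ?I v]) auto
    then show False using t(1) vZ(2) by simp
  qed
qed

text \<open>A point of the slice is outside \<open>lower\<close> if it is missing from
  \<open>S\<close> itself or if its twin at \<open>b\<close> is. Suppose that \<open>x\<close> of
  the first kind is adjacent to \<open>x'\<close> of the second. By \<open>cover\<close>,
  \<open>x(j := b)\<close> and \<open>x'\<close> are in \<open>S\<close>, and a geodesic between
  them changes \<open>j\<close> at \<open>x\<close> or at \<open>x'\<close>: then \<open>x\<close>
  or the twin of \<open>x'\<close> is in \<open>S\<close> after all. So no edge joins the two kinds,
  and \<open>ample_complement_connected\<close> applies.\<close>

lemma geodesic_column: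
  assumes geo: "geodesically_closed m S" and SU: "S \<subseteq> cart m U"
    and j: "j < m" and ab: "a \<in> U j" "a \<noteq> b"
    and low: "ample m (U(j := U j - {b})) (lower j a b S)"
    and Y: "\<And>i. i < m \<Longrightarrow> Y i \<noteq> {}" "\<And>i. i < m \<Longrightarrow> Y i \<subseteq> U i"
    and cover: "\<And>y. y \<in> cart m (Y(j := {a})) \<Longrightarrow> y \<in> S \<or> y(j := b) \<in> S"
  shows "(\<forall>y\<in>cart m (Y(j := {a})). y \<in> S) \<or> (\<forall>y\<in>cart m (Y(j := {a})). y(j := b) \<in> S)"
proof -
  let ?Y = "Y(j := {a})"
  let ?N1 = "{y \<in> cart m ?Y. y \<notin> S}" and ?N2 = "{y \<in> cart m ?Y. y(j := b) \<notin> S}"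
  have Yj: "y j = a" if "y \<in> cart m ?Y" for y using PiE_mem[OF that, of j] j by simp
  have "ample m ?Y (lower j a b S \<inter> cart m ?Y)"
  proof (rule ample_inter_box[OF low])
    show "?Y i \<noteq> {}" if "i < m" for i using Y(1)[OF that] by auto
    show "?Y i \<subseteq> (U(j := U j - {b})) i" if "i < m" for i using Y(2)[OF that] ab by auto
  qed
  then have "?N1 = {} \<or> ?N2 = {}"
  proof (rule ample_complement_connected)
    show "cart m ?Y - lower j a b S \<inter> cart m ?Y = ?N1 \<union> ?N2"
      using Yj ab by (auto simp: lower_def)
    show "?N1 \<inter> ?N2 = {}" using cover by blast
    fix x i c assume x: "x \<in> ?N1" and i: "i < m"
    show "x(i := c) \<notin> ?N2"
    proof
      assume x': "x(i := c) \<in> ?N2"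
      let ?x = "x(i := c)"
      have xa: "x j = a" "?x j = a" using x x' Yj[of x] Yj[of ?x] by blast+
      have 1: "?x \<in> S" using cover[of ?x] x' by blast
      have 2: "x(j := b) \<in> S" using cover[of x] x by blast
      obtain y where y: "y \<in> S" "y j = ?x j" "y(j := (x(j := b)) j) \<in> S"
        "\<And>k. y k = ?x k \<or> y k = (x(j := b)) k"
        using geodesic_square[OF geo 1 2, of j] xa ab by auto
      have yx: "y k = x k" if "k \<noteq> i" for k using y(2) xa y(4)[of k] that by (cases "k = j") auto
      have "y i = c \<or> y i = x i" using y(4)[of i] xa y(2) by (cases "i = j") auto
      moreover have "y = x(i := y i)" using yx by (simp add: fun_eq_iff)
      ultimately have "y = x \<or> y = ?x" by (metis fun_upd_triv)
      then show False
      proof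
        assume "y = x"
        then show False using y(1) x by simp
      next
        assume "y = ?x"
        then show False using y(3) x' by simp
      qed
    qed
  qed
  then show ?thesis by blast
qed

section \<open>Sets with ample minors\<close>

text \<open>Merge the labels of \<open>a\<close> and \<open>b\<close>: a copy in \<open>lower\<close> must pick \<open>a\<close> for the merged label because
  of \<open>z1\<close> and \<open>z2\<close>, and thus provides both an \<open>a\<close>-column and a \<open>b\<close>-column in \<open>S\<close>.\<close>

lemma label_copy_of_separated:
  fixes f :: "nat \<Rightarrow> 'a \<Rightarrow> 'k"
  assumes geo: "geodesically_closed m S" and SU: "S \<subseteq> cart m U"
    and j: "j < m" and ab: "a \<in> U j" "b \<in> U j"
    and low: "ample m (U(j := U j - {b})) (lower j a b S)"
    and sh: "label_shattered m U f S" and fab: "f j a \<noteq> f j b"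
    and z1: "z1 \<in> cart m U" "\<forall>s\<in>S. agree_off m j f s z1 \<and> f j (s j) = f j a \<longrightarrow> s j = a"
    and z2: "z2 \<in> cart m U" "\<forall>s\<in>S. agree_off m j f s z2 \<and> f j (s j) = f j b \<longrightarrow> s j = b"
  shows "\<exists>w. label_copy m U f S w"
proof -
  let ?V = "U(j := U j - {b})" and ?L = "lower j a b S"
  have nab: "a \<noteq> b" using fab by blast
  have V: "z \<in> cart m ?V \<longleftrightarrow> z \<in> cart m U \<and> z j \<noteq> b" for z by (rule cart_remove_iff[OF j])
  have inL: "s \<in> ?L \<longleftrightarrow> s \<in> S \<and> s j \<noteq> b \<and> (s j = a \<longrightarrow> s(j := b) \<in> S)" for s
    by (simp add: lower_def)
  define F where "F i x = (if i = j \<and> f j x = f j a then f j b else f i x)" for i x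
  have Fi: "F i x = f i x" if "i \<noteq> j" for i x using that by (simp add: F_def)
  have shL: "label_shattered m ?V F ?L"
    unfolding label_shattered_def
  proof
    fix z assume zV: "z \<in> cart m ?V"
    then have z: "z \<in> cart m U" using V by blast
    show "\<exists>s\<in>?L. \<forall>i<m. F i (s i) = F i (z i)"
    proof (cases "f j (z j) = f j a \<or> f j (z j) = f j b")
      case True
      then have Fz: "F j (z j) = f j b" by (auto simp: F_def)
      obtain s where s: "s \<in> S" "\<forall>i<m. f i (s i) = f i ((z(j := a)) i)"
        by (rule label_shatteredD[OF sh cart_upd[OF z j ab(1)]])
      obtain t where t: "t \<in> S" "\<forall>i<m. f i (t i) = f i ((z(j := b)) i)"
        by (rule label_shatteredD[OF sh cart_upd[OF z j ab(2)]])
      have sj: "f j (s j) = f j a" using s(2)[rule_format, OF j] by simp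
      have tj: "f j (t j) = f j b" using t(2)[rule_format, OF j] by simp
      have off: "f i (s i) = f i (z i)" "f i (t i) = f i (z i)" if "i < m" "i \<noteq> j" for i
        using s(2)[rule_format, OF that(1)] t(2)[rule_format, OF that(1)] that(2) by simp_all
      \<comment> \<open>Both old labels fit the merged one, so a representative away from
        \<open>a\<close> and \<open>b\<close> is a point of \<open>lower\<close> at once. The
        crossing edge is used when the representatives are exactly at \<open>a\<close> and at
        \<open>b\<close>.\<close>
      consider "s j \<noteq> a" | "t j \<noteq> b" | "s j = a" "t j = b" by blast
      then show ?thesis
      proof cases
        case 1
        have "s j \<noteq> b" using sj fab by auto
        then have "s \<in> ?L" unfolding inL using s(1) 1 by blast
        moreover have "F i (s i) = F i (z i)" if "i < m" for i
          using off[OF that] Fz sj by (cases "i = j") (auto simp: F_def)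
        ultimately show ?thesis by blast
      next
        case 2
        have "t j \<noteq> a" using tj fab by auto
        then have "t \<in> ?L" unfolding inL using t(1) 2 by blast
        moreover have "F i (t i) = F i (z i)" if "i < m" for i
          using off[OF that] Fz tj by (cases "i = j") (auto simp: F_def)
        ultimately show ?thesis by blast
      next
        case 3
        then have "s j \<noteq> t j" using nab by simp
        then obtain y where y: "y \<in> S" "y j = s j" "y(j := t j) \<in> S" "\<And>i. y i = s i \<or> y i = t i"
          using geodesic_square[OF geo s(1) t(1)] by blast
        have "y \<in> ?L" unfolding inL using y(1-3) 3 nab by simp
        moreover have "F i (y i) = F i (z i)" if "i < m" for i
        proof (cases "i = j")
          case True
          then show ?thesis using Fz y(2) 3 by (simp add: F_def)
        next
          case False
          then show ?thesis using off[OF that False] y(4)[of i] Fi[OF False] by metis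
        qed
        ultimately show ?thesis by blast
      qed
    next
      case False
      obtain s where s: "s \<in> S" "\<forall>i<m. f i (s i) = f i (z i)" by (rule label_shatteredD[OF sh z])
      have "s j \<noteq> a" "s j \<noteq> b" using s(2)[rule_format, OF j] False by auto
      then have "s \<in> ?L" unfolding inL using s(1) by blast
      moreover have "F i (s i) = F i (z i)" if "i < m" for i
        using s(2)[rule_format, OF that] by (cases "i = j") (simp_all add: F_def)
      ultimately show ?thesis by blast
    qed
  qed
  obtain w where w: "label_copy m ?V F ?L w" using ampleD[OF low shL] by blast
  have aV: "a \<in> ?V j" using ab nab by simp
  have Fa: "F j a = f j b" by (simp add: F_def)
  define c where "c = w j (f j b)"
  have Fc: "F j c = f j b" using label_copyD1[OF w j aV] by (simp add: Fa c_def)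
  have col: "\<exists>s\<in>?L. s j = c \<and> agree_off m j f s z" if z: "z \<in> cart m U" for z
  proof -
    have "z(j := a) \<in> cart m ?V" using cart_upd[OF z j ab(1)] nab V by simp
    then have 1: "select m w F (z(j := a)) \<in> ?L" by (rule label_copyD2[OF w])
    have 2: "f i (select m w F (z(j := a)) i) = f i (z i)" if i: "i < m" "i \<noteq> j" for i
    proof -
      have "z i \<in> ?V i" using PiE_mem[OF z, of i] i by simp
      then have "F i (w i (F i (z i))) = F i (z i)" by (rule label_copyD1[OF w i(1)])
      then show ?thesis using i by (simp add: Fi)
    qed
    have 3: "select m w F (z(j := a)) j = c" using j by (simp add: Fa c_def)
    show ?thesis using 1 2 3 by blast
  qed
  \<comment> \<open>\<open>c\<close> has one of the two old labels. If it is that of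
    \<open>a\<close>, the copy's point over \<open>z1\<close> forces \<open>c = a\<close>. If it is
    that of \<open>b\<close>, the point over \<open>z2\<close> forces \<open>c = b\<close>, a value
    that \<open>lower\<close> excludes.\<close>
  have ca: "c = a"
  proof (cases "f j c = f j a")
    case True
    obtain s where "s \<in> ?L" "s j = c" "agree_off m j f s z1" using col[OF z1(1)] by blast
    then show ?thesis using z1(2) True inL[of s] by auto
  next
    case False
    then have fc: "f j c = f j b" using Fc by (simp add: F_def)
    obtain s where "s \<in> ?L" "s j = c" "agree_off m j f s z2" using col[OF z2(1)] by blast
    then show ?thesis using z2(2) fc inL[of s] by auto
  qed
  \<comment> \<open>The single column at \<open>a\<close> in \<open>lower\<close> is doubled: the
    twins at \<open>b\<close> serve the label of \<open>b\<close>.\<close>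
  define w' where "w' i k = (if i = j \<and> k = f j a then a else if i = j \<and> k = f j b then b else w i k)" for i k
  have "label_copy m U f S w'"
    unfolding label_copy_def
  proof (intro conjI allI impI ballI)
    fix i x assume ix: "i < m" "x \<in> U i"
    show "f i (w' i (f i x)) = f i x"
    proof (cases "i = j \<and> (f j x = f j a \<or> f j x = f j b)")
      case True
      then show ?thesis by (auto simp: w'_def)
    next
      case False
      have "x \<in> ?V i" using ix False by auto
      then have "F i (w i (F i x)) = F i x" by (rule label_copyD1[OF w ix(1)])
      moreover have "F i x = f i x" using False by (auto simp: F_def)
      ultimately have F: "F i (w i (f i x)) = f i x" by simp
      then have "f i (w i (f i x)) = f i x"
        using False by (cases "i = j") (auto simp: F_def split: if_splits)
      then show ?thesis using False by (auto simp: w'_def)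
    qed
  next
    fix z assume z: "z \<in> cart m U"
    show "select m w' f z \<in> S"
    proof (cases "f j (z j) = f j a \<or> f j (z j) = f j b")
      case True
      have "z(j := a) \<in> cart m ?V" using cart_upd[OF z j ab(1)] nab V by simp
      then have L: "select m w F (z(j := a)) \<in> ?L" by (rule label_copyD2[OF w])
      have sj: "select m w F (z(j := a)) j = a" using j ca by (simp add: Fa c_def)
      show ?thesis
      proof (cases "f j (z j) = f j a")
        case True
        have "select m w' f z = select m w F (z(j := a))"
          using True ca by (intro select_cong) (auto simp: w'_def Fi Fa c_def)
        then show ?thesis using L inL by simp
      next
        case False
        then have fb: "f j (z j) = f j b" using True by blast
        have "(select m w F (z(j := a)))(j := b) = select m w' f z"
          using False fb j by (intro select_upd) (auto simp: w'_def Fi)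
        moreover have "(select m w F (z(j := a)))(j := b) \<in> S" using L sj inL by blast
        ultimately show ?thesis by simp
      qed
    next
      case False
      then have "z \<in> cart m ?V" using V z by auto
      then have "select m w F z \<in> ?L" by (rule label_copyD2[OF w])
      moreover have "select m w' f z = select m w F z"
        using False by (intro select_cong) (auto simp: w'_def F_def)
      ultimately show ?thesis using inL by simp
    qed
  qed
  then show ?thesis by blast
qed

text \<open>\<open>lower\<close> and \<open>upper\<close> are asymmetric, \<open>a\<close> being the
  representative that is kept. Exchanging the representatives lets an argument about the block of
  \<open>a\<close> be used for the block of \<open>b\<close>.\<close>

lemma ample_swap:
  assumes ample: "ample m (U(j := U j - {b})) T" and ne: "\<And>i. i < m \<Longrightarrow> U i \<noteq> {}"
    and j: "j < m" and ab: "a \<in> U j" "b \<in> U j" "a \<noteq> b"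
  shows "ample m (U(j := U j - {a})) ((\<lambda>x. if x j = a then x(j := b) else x) ` T)"
proof -
  define \<phi> where "\<phi> i x = (if i = j \<and> x = a then b else x)" for i x
  have "ample m (U(j := U j - {a})) ((\<lambda>x. \<lambda>i\<in>{..<m}. \<phi> i (x i)) ` T)"
  proof (rule ample_map[OF ample])
    show "(U(j := U j - {b})) i \<noteq> {}" if "i < m" for i using ne[OF that] ab by auto
    show "bij_betw (\<phi> i) ((U(j := U j - {b})) i) ((U(j := U j - {a})) i)" for i
    proof (cases "i = j")
      case True
      have "inj_on (\<phi> j) (U j - {b})" by (auto simp: inj_on_def \<phi>_def)
      moreover have "\<phi> j ` (U j - {b}) = U j - {a}" using ab by (auto simp: \<phi>_def image_iff)
      ultimately show ?thesis using True by (simp add: bij_betw_def)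
    next
      case False
      then show ?thesis by (simp add: \<phi>_def bij_betw_def inj_on_def)
    qed
  qed
  moreover have "(\<lambda>x. \<lambda>i\<in>{..<m}. \<phi> i (x i)) ` T = (\<lambda>x. if x j = a then x(j := b) else x) ` T"
  proof (rule image_cong[OF refl])
    fix x assume "x \<in> T"
    then have x: "x \<in> cart m (U(j := U j - {b}))" using ample_subset[OF ample] by blast
    show "(\<lambda>i\<in>{..<m}. \<phi> i (x i)) = (if x j = a then x(j := b) else x)"
    proof
      fix i show "(\<lambda>i\<in>{..<m}. \<phi> i (x i)) i = (if x j = a then x(j := b) else x) i"
        using j PiE_arb[OF x, of i] by (cases "i < m") (auto simp: \<phi>_def)
    qed
  qed
  ultimately show ?thesis by simp
qed

lemma lower_swap:
  assumes "a \<noteq> b"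
  shows "(\<lambda>x. if x j = a then x(j := b) else x) ` lower j a b S = lower j b a S"
proof (intro equalityI subsetI)
  fix y assume "y \<in> (\<lambda>x. if x j = a then x(j := b) else x) ` lower j a b S"
  then obtain x where x: "x \<in> lower j a b S" "y = (if x j = a then x(j := b) else x)" by blast
  show "y \<in> lower j b a S"
  proof (cases "x j = a")
    case True
    then have "y = x(j := b)" "y(j := a) = x" using x(2) by (simp_all add: fun_eq_iff)
    then show ?thesis using x(1) True assms by (simp add: lower_def)
  next
    case False
    then show ?thesis using x by (simp add: lower_def)
  qed
next
  fix y assume y: "y \<in> lower j b a S"
  define x where "x = (if y j = b then y(j := a) else y)"
  have "x \<in> lower j a b S"
  proof (cases "y j = b")
    case True
    then have "x = y(j := a)" "x(j := b) = y" by (simp_all add: fun_eq_iff x_def)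
    then show ?thesis using y True assms by (simp add: lower_def)
  next
    case False
    then show ?thesis using y by (simp add: lower_def x_def)
  qed
  moreover have "y = (if x j = a then x(j := b) else x)"
    using y assms by (auto simp: x_def lower_def fun_eq_iff)
  ultimately show "y \<in> (\<lambda>x. if x j = a then x(j := b) else x) ` lower j a b S" by blast
qed

lemma upper_swap:
  assumes "a \<noteq> b"
  shows "(\<lambda>x. if x j = a then x(j := b) else x) ` upper j a b S = upper j b a S"
  unfolding upper_def image_image using assms by (intro image_cong refl) (auto simp: fun_eq_iff)

text \<open>A point of \<open>upper\<close> at \<open>a\<close> comes from a point of
  \<open>S\<close> at \<open>a\<close> or at \<open>b\<close>, and which one may vary along the
  column over \<open>c\<close>. Applying \<open>geodesic_column\<close> to the box of all values
  used by the copy makes the choice uniform.\<close>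

lemma upper_column:
  fixes f :: "nat \<Rightarrow> 'a \<Rightarrow> 'k"
  assumes geo: "geodesically_closed m S" and SU: "S \<subseteq> cart m U"
    and ne: "\<And>i. i < m \<Longrightarrow> U i \<noteq> {}"
    and j: "j < m" and a: "a \<in> U j" and nab: "a \<noteq> b"
    and low: "ample m (U(j := U j - {b})) (lower j a b S)"
    and sel: "\<And>z. z \<in> cart m U \<Longrightarrow> select m w f z \<in> upper j a b S"
    and c: "c \<in> U j" "w j (f j c) = a"
  shows "(\<forall>z\<in>cart m U. z j = c \<longrightarrow> select m w f z \<in> S)
    \<or> (\<forall>z\<in>cart m U. z j = c \<longrightarrow> (select m w f z)(j := b) \<in> S)"
proof -
  let ?V = "U(j := U j - {b})"
  have V: "z \<in> cart m ?V \<longleftrightarrow> z \<in> cart m U \<and> z j \<noteq> b" for z by (rule cart_remove_iff[OF j])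
  have cover: "t \<in> S \<or> t(j := b) \<in> S" if t: "t \<in> upper j a b S" for t
  proof -
    obtain x where x: "x \<in> S" "t = (if x j = b then x(j := a) else x)" using t by (auto simp: upper_def)
    show ?thesis
    proof (cases "x j = b")
      case True
      then have "t(j := b) = x" using x(2) by (simp add: fun_eq_iff)
      then show ?thesis using x(1) by simp
    qed (use x in simp)
  qed
  define Y where "Y i = w i ` f i ` U i" for i
  have wU: "w i (f i x) \<in> U i" if ix: "i < m" "x \<in> U i" for i x
  proof -
    obtain z where z: "z \<in> cart m U" "z i = x" by (rule cart_extend[where Z = U, OF ne ix])
    have "upper j a b S \<subseteq> cart m ?V" by (rule upper_cart[OF j SU a nab])
    then have "select m w f z \<in> cart m ?V" using sel[OF z(1)] by blast
    then have "select m w f z \<in> cart m U" using V by blast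
    then have "select m w f z i \<in> U i" by (rule PiE_mem) (use ix in simp)
    then show ?thesis using z(2) ix(1) by simp
  qed
  have colsel: "\<exists>z\<in>cart m U. z j = c \<and> y = select m w f z" if y: "y \<in> cart m (Y(j := {a}))" for y
  proof -
    have "\<forall>i\<in>{..<m}. \<exists>x. x \<in> U i \<and> y i = w i (f i x) \<and> (i = j \<longrightarrow> x = c)"
    proof
      fix i assume i: "i \<in> {..<m}"
      show "\<exists>x. x \<in> U i \<and> y i = w i (f i x) \<and> (i = j \<longrightarrow> x = c)"
      proof (cases "i = j")
        case True
        then show ?thesis using PiE_mem[OF y i] c by (intro exI[of _ c]) simp
      next
        case False
        then have "y i \<in> Y i" using PiE_mem[OF y i] by simp
        then show ?thesis using False by (auto simp: Y_def)
      qed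
    qed
    then obtain x where x: "\<forall>i\<in>{..<m}. x i \<in> U i \<and> y i = w i (f i (x i)) \<and> (i = j \<longrightarrow> x i = c)"
      by (rule bchoice[THEN exE])
    have "restrict x {..<m} \<in> cart m U" using x unfolding restrict_PiE_iff by blast
    moreover have "restrict x {..<m} j = c" using x j by simp
    moreover have "y = select m w f (restrict x {..<m})"
    proof
      fix i show "y i = select m w f (restrict x {..<m}) i"
        using x PiE_arb[OF y, of i] by (cases "i < m") (auto simp: select_def)
    qed
    ultimately show ?thesis by blast
  qed
  have selcol: "select m w f z \<in> cart m (Y(j := {a}))" if z: "z \<in> cart m U" "z j = c" for z
    unfolding select_def restrict_PiE_iff
    using PiE_mem[OF z(1)] z(2) c(2) by (auto simp: Y_def)
  have "(\<forall>y\<in>cart m (Y(j := {a})). y \<in> S) \<or> (\<forall>y\<in>cart m (Y(j := {a})). y(j := b) \<in> S)"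
  proof (rule geodesic_column[OF geo SU j a nab low])
    show "Y i \<noteq> {}" if "i < m" for i using ne[OF that] by (simp add: Y_def)
    show "Y i \<subseteq> U i" if "i < m" for i using wU[OF that] by (auto simp: Y_def)
    fix y assume "y \<in> cart m (Y(j := {a}))"
    then obtain z where "z \<in> cart m U" "y = select m w f z" using colsel by blast
    then show "y \<in> S \<or> y(j := b) \<in> S" using cover sel by simp
  qed
  then show ?thesis using selcol by blast
qed

text \<open>By \<open>pop\<close>, the block of \<open>a\<close> can spare \<open>a\<close>: every
  pattern still meets it elsewhere. Moving \<open>a\<close> into the block of \<open>b\<close> gives
  a labelling compatible with the merging. Either \<open>lower\<close> is shattered by it, or some
  pattern fails in such a way that the copy found in \<open>upper\<close> can only be lifted to
  \<open>b\<close>.\<close>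

lemma label_copy_of_populated:
  fixes f :: "nat \<Rightarrow> 'a \<Rightarrow> 'k"
  assumes geo: "geodesically_closed m S" and SU: "S \<subseteq> cart m U"
    and ne: "\<And>i. i < m \<Longrightarrow> U i \<noteq> {}"
    and j: "j < m" and ab: "a \<in> U j" "b \<in> U j"
    and low: "ample m (U(j := U j - {b})) (lower j a b S)"
    and up: "ample m (U(j := U j - {b})) (upper j a b S)"
    and sh: "label_shattered m U f S" and fab: "f j a \<noteq> f j b"
    and pop: "\<forall>z\<in>cart m U. \<exists>s\<in>S. s j \<noteq> a \<and> f j (s j) = f j a \<and> agree_off m j f s z"
  shows "\<exists>w. label_copy m U f S w"
proof -
  let ?V = "U(j := U j - {b})" and ?L = "lower j a b S"
  have nab: "a \<noteq> b" using fab by blast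
  have V: "z \<in> cart m ?V \<longleftrightarrow> z \<in> cart m U \<and> z j \<noteq> b" for z by (rule cart_remove_iff[OF j])
  have inL: "s \<in> ?L \<longleftrightarrow> s \<in> S \<and> s j \<noteq> b \<and> (s j = a \<longrightarrow> s(j := b) \<in> S)" for s
    by (simp add: lower_def)
  define F where "F i x = f i (if i = j \<and> x = a then b else x)" for i x
  have Fi: "F i x = f i x" if "i \<noteq> j \<or> x \<noteq> a" for i x using that by (auto simp: F_def)
  have Fa: "F j a = f j b" by (simp add: F_def)
  have "cart m U \<noteq> {}" using ne PiE_eq_empty_iff[of "{..<m}" U] by blast
  then obtain z0 where z0: "z0 \<in> cart m U" by blast
  \<comment> \<open>A further point of the block of \<open>a\<close> keeps the label
    \<open>f j a\<close> in use after \<open>a\<close> has left the block.\<close>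
  obtain c where c: "c \<in> U j" "c \<noteq> a" "c \<noteq> b" "f j c = f j a"
  proof -
    obtain s where s: "s \<in> S" "s j \<noteq> a" "f j (s j) = f j a" using pop z0 by blast
    have "s \<in> cart m U" using s(1) SU by blast
    then have "s j \<in> U j" using j by (intro PiE_mem[of s]) auto
    moreover have "s j \<noteq> b" using s(3) fab by auto
    ultimately show thesis using that s(2,3) by blast
  qed
  have lift: "\<exists>y\<in>?V i. F i y = f i x" if "x \<in> U i" for i x
  proof (cases "i = j \<and> (x = a \<or> x = b)")
    case True
    then show ?thesis using c Fi[of i c] Fa ab nab by (auto intro: bexI[of _ c] bexI[of _ a])
  next
    case False
    then show ?thesis using that Fi[of i x] by (intro bexI[of _ x]) auto
  qed
  have liftz: "\<exists>y\<in>cart m ?V. \<forall>i<m. F i (y i) = f i (z i)" if z: "z \<in> cart m U" for z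
  proof -
    have "\<forall>i\<in>{..<m}. \<exists>y. y \<in> ?V i \<and> F i y = f i (z i)" using lift[OF PiE_mem[OF z]] by blast
    then obtain y where y: "\<forall>i\<in>{..<m}. y i \<in> ?V i \<and> F i (y i) = f i (z i)" by (rule bchoice[THEN exE])
    have "restrict y {..<m} \<in> cart m ?V" using y unfolding restrict_PiE_iff by blast
    moreover have "\<forall>i<m. F i (restrict y {..<m} i) = f i (z i)" using y by simp
    ultimately show ?thesis by blast
  qed
  \<comment> \<open>Where a copy for \<open>F\<close> chooses \<open>a\<close>, the label wanted is
    that of \<open>b\<close>, which \<open>a\<close> does not have under \<open>f\<close>; so
    \<open>b\<close> takes its place.\<close>
  define repl where "repl w i k = (if i = j \<and> w i k = a then b else w i k)" for w :: "nat \<Rightarrow> 'k \<Rightarrow> 'a" and i k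
  have repl_lab: "f i (repl w i (f i x)) = f i x"
    if w: "label_copy m ?V F T w" and ix: "i < m" "x \<in> U i" for w T i x
  proof -
    obtain y where y: "y \<in> ?V i" "F i y = f i x" using lift[OF ix(2)] by blast
    have "F i (w i (F i y)) = F i y" by (rule label_copyD1[OF w ix(1) y(1)])
    then have "F i (w i (f i x)) = f i x" unfolding y(2) .
    then show ?thesis by (simp only: F_def repl_def)
  qed
  have repl_sel: "\<exists>t\<in>T. t = select m w f z \<and> select m (repl w) f z = (if t j = a then t(j := b) else t)"
    if w: "label_copy m ?V F T w" and z: "z \<in> cart m U" for w T z
  proof -
    obtain y where y: "y \<in> cart m ?V" "\<forall>i<m. F i (y i) = f i (z i)" using liftz[OF z] by blast
    have 1: "select m w F y = select m w f z" using y(2) by (intro select_cong) simp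
    have 2: "select m w F y \<in> T" by (rule label_copyD2[OF w y(1)])
    have "select m (repl w) f z = (if select m w f z j = a then (select m w f z)(j := b) else select m w f z)"
    proof
      fix i show "select m (repl w) f z i = (if select m w f z j = a then (select m w f z)(j := b) else select m w f z) i"
        using j by (cases "i < m"; cases "i = j") (auto simp: repl_def select_def)
    qed
    then show ?thesis using 1 2 by (intro bexI[of _ "select m w f z"]) auto
  qed
  \<comment> \<open>This is what supplies a point of \<open>lower\<close> over \<open>z\<close> in
    the enlarged block: a point of the old block other than \<open>b\<close> is in
    \<open>lower\<close> outright, and points at both \<open>a\<close> and \<open>b\<close> give one
    by \<open>geodesic_square\<close>.\<close>
  define rich where "rich z \<longleftrightarrow> (\<exists>s\<in>S. s j \<noteq> b \<and> f j (s j) = f j b \<and> agree_off m j f s z)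
      \<or> ((\<exists>s\<in>S. s j = a \<and> agree_off m j f s z) \<and> (\<exists>s\<in>S. s j = b \<and> agree_off m j f s z))" for z
  show ?thesis
  proof (cases "\<forall>z\<in>cart m U. rich z")
    case True
    have "label_shattered m ?V F ?L"
      unfolding label_shattered_def
    proof
      fix z assume zV: "z \<in> cart m ?V"
      then have z: "z \<in> cart m U" "z j \<noteq> b" using V by auto
      have wrap: "\<exists>s\<in>?L. \<forall>i<m. F i (s i) = F i (z i)"
        if "s \<in> ?L" "F j (s j) = F j (z j)" "agree_off m j f s z" for s
      proof -
        have "F i (s i) = F i (z i)" if i: "i < m" for i
          using that \<open>F j (s j) = F j (z j)\<close> \<open>agree_off m j f s z\<close> by (cases "i = j") (simp_all add: Fi)
        then show ?thesis using \<open>s \<in> ?L\<close> by blast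
      qed
      consider (b) "F j (z j) = f j b" | (a) "F j (z j) = f j a" | (o) "F j (z j) \<noteq> f j b" "F j (z j) \<noteq> f j a" by blast
      then show "\<exists>s\<in>?L. \<forall>i<m. F i (s i) = F i (z i)"
      proof cases
        case b
        have "rich z" using True z(1) by blast
        then consider
            (d) s where "s \<in> S" "s j \<noteq> b" "f j (s j) = f j b" "agree_off m j f s z"
          | (ab) s t where "s \<in> S" "s j = a" "agree_off m j f s z" "t \<in> S" "t j = b" "agree_off m j f t z"
          unfolding rich_def by blast
        then show ?thesis
        proof cases
          case d
          have sa: "s j \<noteq> a" using d(3) fab by auto
          have "s \<in> ?L" unfolding inL using d sa by blast
          then show ?thesis using wrap d(3,4) b Fi[of j "s j"] sa by simp
        next
          case ab
          have "s j \<noteq> t j" using ab nab by simp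
          then obtain y where y: "y \<in> S" "y j = s j" "y(j := t j) \<in> S" "\<And>i. y i = s i \<or> y i = t i"
            using geodesic_square[OF geo ab(1,4)] by blast
          have "y \<in> ?L" unfolding inL using y(1-3) ab nab by simp
          moreover have "F j (y j) = F j (z j)" using y(2) ab(2) b Fa by simp
          moreover have "agree_off m j f y z"
          proof (intro allI impI)
            fix i assume i: "i < m" "i \<noteq> j"
            then have "f i (s i) = f i (z i)" "f i (t i) = f i (z i)" using ab(3,6) by simp_all
            then show "f i (y i) = f i (z i)" using y(4)[of i] by metis
          qed
          ultimately show ?thesis by (rule wrap)
        qed
      next
        case a
        obtain s where s: "s \<in> S" "s j \<noteq> a" "f j (s j) = f j a" "agree_off m j f s z" using pop z(1) by blast
        have "s j \<noteq> b" using s(3) fab by auto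
        then have "s \<in> ?L" unfolding inL using s by blast
        then show ?thesis using wrap s a Fi[of j "s j"] by simp
      next
        case o
        have za: "z j \<noteq> a" using o Fa by auto
        obtain s where s: "s \<in> S" "\<forall>i<m. f i (s i) = f i (z i)" by (rule label_shatteredD[OF sh z(1)])
        have fs: "f j (s j) = F j (z j)" using s(2) j Fi[of j "z j"] za by simp
        have sa: "s j \<noteq> a" using o fs by auto
        have sb: "s j \<noteq> b" using o fs by auto
        have "s \<in> ?L" unfolding inL using s sa sb by blast
        then show ?thesis using wrap s fs Fi[of j "s j"] sa by simp
      qed
    qed
    then obtain w where w: "label_copy m ?V F ?L w" using ampleD[OF low] by blast
    have "label_copy m U f S (repl w)"
      unfolding label_copy_def
    proof (intro conjI allI impI ballI)
      fix i x assume "i < m" "x \<in> U i"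
      then show "f i (repl w i (f i x)) = f i x" by (rule repl_lab[OF w])
    next
      fix z assume "z \<in> cart m U"
      from repl_sel[OF w this] obtain t where "t \<in> ?L" "select m (repl w) f z = (if t j = a then t(j := b) else t)" by blast
      then show "select m (repl w) f z \<in> S" using inL[of t] by simp
    qed
    then show ?thesis by blast
  next
    case False
    then obtain z1 where z1: "z1 \<in> cart m U" "\<not> rich z1" by blast
    have z1b: "\<forall>s\<in>S. f j (s j) = f j b \<and> agree_off m j f s z1 \<longrightarrow> s j = b"
      using z1(2) unfolding rich_def by (simp only: de_Morgan_disj bex_simps) auto
    have z1a: "(\<forall>s\<in>S. agree_off m j f s z1 \<longrightarrow> s j \<noteq> a) \<or> (\<forall>s\<in>S. agree_off m j f s z1 \<longrightarrow> s j \<noteq> b)"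
      using z1(2) unfolding rich_def by (simp only: de_Morgan_disj bex_simps) auto
    obtain s1 where s1: "s1 \<in> S" "\<forall>i<m. f i (s1 i) = f i ((z1(j := b)) i)"
      by (rule label_shatteredD[OF sh cart_upd[OF z1(1) j ab(2)]])
    have "f j (s1 j) = f j b" using s1(2)[rule_format, OF j] by simp
    moreover have "agree_off m j f s1 z1" using s1(2) by simp
    ultimately have "s1 j = b" "agree_off m j f s1 z1" using z1b s1(1) by auto
    then have no_a: "\<forall>s\<in>S. agree_off m j f s z1 \<longrightarrow> s j \<noteq> a" using z1a s1(1) by blast
    have "label_shattered m ?V F (upper j a b S)"
      unfolding label_shattered_def
    proof
      fix z assume zV: "z \<in> cart m ?V"
      then have z: "z \<in> cart m U" "z j \<noteq> b" using V by auto
      define x where "x = (if z j = a then b else z j)"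
      have x: "F j (z j) = f j x" by (simp add: F_def x_def)
      have "x \<in> U j" using ab PiE_mem[OF z(1), of j] j by (simp add: x_def)
      then have zx: "z(j := x) \<in> cart m U" by (rule cart_upd[OF z(1) j])
      obtain s where s: "s \<in> S" "s j \<noteq> a" "\<forall>i<m. f i (s i) = f i ((z(j := x)) i)"
      proof (cases "f j x = f j a")
        case True
        obtain s where s: "s \<in> S" "s j \<noteq> a" "f j (s j) = f j a" "agree_off m j f s z" using pop z(1) by blast
        then have "\<forall>i<m. f i (s i) = f i ((z(j := x)) i)" using True by simp
        then show thesis using that s by blast
      next
        case False
        obtain s where s: "s \<in> S" "\<forall>i<m. f i (s i) = f i ((z(j := x)) i)" by (rule label_shatteredD[OF sh zx])
        have "f j (s j) = f j x" using s(2)[rule_format, OF j] by simp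
        then have "s j \<noteq> a" using False by auto
        then show thesis using that s by blast
      qed
      define t where "t = (if s j = b then s(j := a) else s)"
      have "t \<in> upper j a b S" unfolding upper_def t_def using s(1) by (intro image_eqI[of _ _ s]) simp_all
      moreover have "F i (t i) = F i (z i)" if i: "i < m" for i
      proof (cases "i = j")
        case True
        have "f j (s j) = f j x" using s(3)[rule_format, OF j] by simp
        moreover have "F j (t j) = f j (s j)" using s(2) by (auto simp: t_def F_def)
        ultimately show ?thesis using True x by simp
      next
        case False
        then show ?thesis using s(3)[rule_format, OF i] by (simp add: t_def Fi)
      qed
      ultimately show "\<exists>s\<in>upper j a b S. \<forall>i<m. F i (s i) = F i (z i)" by blast
    qed
    then obtain w where w: "label_copy m ?V F (upper j a b S) w" using ampleD[OF up] by blast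
    have upS: "t \<in> S" if "t \<in> upper j a b S" "t j \<noteq> a" for t
      using that by (auto simp: upper_def split: if_splits)
    have upb: "t j \<noteq> b" if "t \<in> upper j a b S" for t
      using that nab by (auto simp: upper_def)
    have FW: "F i (w i (f i x)) = f i x" if ix: "i < m" "x \<in> U i" for i x
    proof -
      obtain y where y: "y \<in> ?V i" "F i y = f i x" using lift[OF ix(2)] by blast
      have "F i (w i (F i y)) = F i y" by (rule label_copyD1[OF w ix(1) y(1)])
      then show ?thesis unfolding y(2) .
    qed
    have selU: "select m w f z \<in> upper j a b S" if "z \<in> cart m U" for z
      using repl_sel[OF w that] by blast
    have zb: "z1(j := b) \<in> cart m U" by (rule cart_upd[OF z1(1) j ab(2)])
    let ?t = "select m w f (z1(j := b))"
    have off1: "agree_off m j f ?t z1"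
    proof (intro allI impI)
      fix i assume i: "i < m" "i \<noteq> j"
      show "f i (?t i) = f i (z1 i)" using FW[OF i(1) PiE_mem[OF z1(1)]] i by (simp add: Fi)
    qed
    \<comment> \<open>Any other value would put the point over \<open>z1(j := b)\<close> into
      \<open>S\<close>, where \<open>z1\<close> forces it to be at \<open>b\<close>; but
      \<open>upper\<close> has no point at \<open>b\<close>.\<close>
    have wb: "w j (f j b) = a"
    proof (rule ccontr)
      assume na: "w j (f j b) \<noteq> a"
      have tj: "?t j = w j (f j b)" using j by simp
      have tS: "?t \<in> S" using upS[OF selU[OF zb]] tj na by simp
      have "f j (?t j) = f j b" using FW[OF j ab(2)] na tj by (simp add: Fi)
      then have "?t j = b" using z1b tS off1 by blast
      then show False using upb[OF selU[OF zb]] by simp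
    qed
    have wk: "w j k \<noteq> a" if "x \<in> U j" "k = f j x" "k \<noteq> f j b" for k x
      using FW[OF j that(1)] that(2,3) Fa by auto
    have "(\<forall>z\<in>cart m U. z j = b \<longrightarrow> select m w f z \<in> S)
        \<or> (\<forall>z\<in>cart m U. z j = b \<longrightarrow> (select m w f z)(j := b) \<in> S)"
      by (rule upper_column[OF geo SU ne j ab(1) nab low selU ab(2) wb])
    \<comment> \<open>Over the pattern of \<open>z1\<close> no point of \<open>S\<close> is at
      \<open>a\<close>, so the uniform lift of this column is to \<open>b\<close>.\<close>
    moreover have "\<not> (\<forall>z\<in>cart m U. z j = b \<longrightarrow> select m w f z \<in> S)"
    proof
      assume all: "\<forall>z\<in>cart m U. z j = b \<longrightarrow> select m w f z \<in> S"
      have "?t \<in> S" using all[rule_format, OF zb] by simp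
      then have "?t j \<noteq> a" using no_a off1 by blast
      then show False using wb j by simp
    qed
    ultimately have bcol: "\<forall>z\<in>cart m U. z j = b \<longrightarrow> (select m w f z)(j := b) \<in> S" by blast
    have "label_copy m U f S (repl w)"
      unfolding label_copy_def
    proof (intro conjI allI impI ballI)
      fix i x assume "i < m" "x \<in> U i"
      then show "f i (repl w i (f i x)) = f i x" by (rule repl_lab[OF w])
    next
      fix z assume z: "z \<in> cart m U"
      from repl_sel[OF w z] have t: "select m w f z \<in> upper j a b S"
        "select m (repl w) f z = (if select m w f z j = a then (select m w f z)(j := b) else select m w f z)" by auto
      show "select m (repl w) f z \<in> S"
      proof (cases "f j (z j) = f j b")
        case True
        have zj: "z(j := b) \<in> cart m U" by (rule cart_upd[OF z j ab(2)])
        have "select m w f z = select m w f (z(j := b))" using True by (intro select_cong) auto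
        then have "(select m w f z)(j := b) \<in> S" using bcol[rule_format, OF zj] by simp
        moreover have "select m w f z j = a" using True wb j by simp
        ultimately show ?thesis using t(2) by simp
      next
        case False
        have "select m w f z j \<noteq> a" using wk[OF PiE_mem[OF z] refl False] j by simp
        then show ?thesis using upS[OF t(1)] t(2) by simp
      qed
    qed
    then show ?thesis by blast
  qed
qed

text \<open>A copy in \<open>upper\<close> can leave \<open>S\<close> only where it chooses
  \<open>a\<close>, which only the common label of \<open>a\<close> and \<open>b\<close> can do.
  \<open>upper_column\<close> decides whether this value stays or is changed to \<open>b\<close>;
  its label is right either way.\<close>

lemma label_copy_of_merged:
  fixes f :: "nat \<Rightarrow> 'a \<Rightarrow> 'k"
  assumes geo: "geodesically_closed m S" and SU: "S \<subseteq> cart m U"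
    and ne: "\<And>i. i < m \<Longrightarrow> U i \<noteq> {}"
    and j: "j < m" and ab: "a \<in> U j" "b \<in> U j" "a \<noteq> b"
    and low: "ample m (U(j := U j - {b})) (lower j a b S)"
    and up: "ample m (U(j := U j - {b})) (upper j a b S)"
    and sh: "label_shattered m U f S" and fab: "f j a = f j b"
  shows "\<exists>w. label_copy m U f S w"
proof -
  let ?V = "U(j := U j - {b})"
  have V: "z \<in> cart m ?V \<longleftrightarrow> z \<in> cart m U \<and> z j \<noteq> b" for z by (rule cart_remove_iff[OF j])
  have "label_shattered m ?V f (upper j a b S)"
    unfolding label_shattered_def
  proof
    fix z assume "z \<in> cart m ?V"
    then have "z \<in> cart m U" using V by blast
    then obtain s where s: "s \<in> S" "\<forall>i<m. f i (s i) = f i (z i)" by (rule label_shatteredD[OF sh])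
    define t where "t = (if s j = b then s(j := a) else s)"
    have "t \<in> upper j a b S" unfolding upper_def t_def using s(1) by (intro image_eqI[of _ _ s]) simp_all
    moreover have "f i (t i) = f i (z i)" if "i < m" for i
      using s(2)[rule_format, OF that] fab by (cases "i = j") (auto simp: t_def)
    ultimately show "\<exists>s\<in>upper j a b S. \<forall>i<m. f i (s i) = f i (z i)" by blast
  qed
  then obtain w where w: "label_copy m ?V f (upper j a b S) w" using ampleD[OF up] by blast
  have lab: "f i (w i (f i x)) = f i x" if ix: "i < m" "x \<in> U i" for i x
  proof (cases "i = j \<and> x = b")
    case True
    then show ?thesis using label_copyD1[OF w j, of a] ab fab by simp
  next
    case False
    then show ?thesis using ix by (intro label_copyD1[OF w]) auto
  qed
  have sel: "select m w f z \<in> upper j a b S" if z: "z \<in> cart m U" for z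
  proof (cases "z j = b")
    case True
    have "z(j := a) \<in> cart m ?V" using cart_upd[OF z j ab(1)] V ab(3) by simp
    moreover have "select m w f z = select m w f (z(j := a))"
      using True fab by (intro select_cong) auto
    ultimately show ?thesis using label_copyD2[OF w] by simp
  next
    case False
    then have "z \<in> cart m ?V" using V z by blast
    then show ?thesis by (rule label_copyD2[OF w])
  qed
  have upS: "t \<in> S" if "t \<in> upper j a b S" "t j \<noteq> a" for t
    using that by (auto simp: upper_def split: if_splits)
  have selS: "select m w f z \<in> S" if z: "z \<in> cart m U" "w j (f j (z j)) \<noteq> a" for z
    using upS[OF sel[OF z(1)]] z(2) j by simp
  have wk: "w j (f j x) \<noteq> a" if "x \<in> U j" "f j x \<noteq> f j a" for x
    using lab[OF j that(1)] that(2) by auto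
  show ?thesis
  proof (cases "w j (f j a) = a")
    case False
    have "w j (f j x) \<noteq> a" if "x \<in> U j" for x using wk[OF that] False by metis
    then have "label_copy m U f S w"
      unfolding label_copy_def
    proof (intro conjI allI impI ballI)
      fix z assume z: "z \<in> cart m U"
      have "z j \<in> U j" using PiE_mem[OF z, of j] j by simp
      then show "select m w f z \<in> S" using selS[OF z] \<open>\<And>x. x \<in> U j \<Longrightarrow> w j (f j x) \<noteq> a\<close> by blast
    qed (rule lab)
    then show ?thesis by blast
  next
    case True
    have "(\<forall>z\<in>cart m U. z j = a \<longrightarrow> select m w f z \<in> S)
        \<or> (\<forall>z\<in>cart m U. z j = a \<longrightarrow> (select m w f z)(j := b) \<in> S)"
      by (rule upper_column[OF geo SU ne j ab(1,3) low sel ab(1) True])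
    then show ?thesis
    proof
      assume all: "\<forall>z\<in>cart m U. z j = a \<longrightarrow> select m w f z \<in> S"
      have "label_copy m U f S w"
        unfolding label_copy_def
      proof (intro conjI allI impI ballI)
        fix i x assume "i < m" "x \<in> U i"
        then show "f i (w i (f i x)) = f i x" by (rule lab)
      next
        fix z assume z: "z \<in> cart m U"
        show "select m w f z \<in> S"
        proof (cases "f j (z j) = f j a")
          case eq: True
          have "select m w f z = select m w f (z(j := a))" using eq by (intro select_cong) auto
          then show ?thesis using all[rule_format, OF cart_upd[OF z j ab(1)]] by simp
        next
          case False
          have "z j \<in> U j" using PiE_mem[OF z, of j] j by simp
          then show ?thesis using selS[OF z wk] False by simp
        qed
      qed
      then show ?thesis by blast
    next
      assume all: "\<forall>z\<in>cart m U. z j = a \<longrightarrow> (select m w f z)(j := b) \<in> S"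
      define w' where "w' i k = (if i = j \<and> k = f j a then b else w i k)" for i k
      have "label_copy m U f S w'"
        unfolding label_copy_def
      proof (intro conjI allI impI ballI)
        fix i x assume "i < m" "x \<in> U i"
        then show "f i (w' i (f i x)) = f i x" using lab fab by (auto simp: w'_def)
      next
        fix z assume z: "z \<in> cart m U"
        show "select m w' f z \<in> S"
        proof (cases "f j (z j) = f j a")
          case eq: True
          have "(select m w f (z(j := a)))(j := b) = select m w' f z"
            using j eq by (intro select_upd) (auto simp: w'_def)
          then show ?thesis using all[rule_format, OF cart_upd[OF z j ab(1)]] by simp
        next
          case False
          have "z j \<in> U j" using PiE_mem[OF z, of j] j by simp
          then have "select m w f z \<in> S" using selS[OF z wk] False by simp
          moreover have "select m w' f z = select m w f z"
            using False by (intro select_cong) (auto simp: w'_def)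
          ultimately show ?thesis by simp
        qed
      qed
      then show ?thesis by blast
    qed
  qed
qed

lemma ample_of_lower_upper:
  assumes geo: "geodesically_closed m S" and SU: "S \<subseteq> cart m U"
    and ne: "\<And>i. i < m \<Longrightarrow> U i \<noteq> {}"
    and j: "j < m" and ab: "a \<in> U j" "b \<in> U j" "a \<noteq> b"
    and low: "ample m (U(j := U j - {b})) (lower j a b S)"
    and up: "ample m (U(j := U j - {b})) (upper j a b S)"
  shows "ample m U S"
proof (rule ampleI[OF SU ne])
  fix f :: "nat \<Rightarrow> 'a \<Rightarrow> 'a set"
  assume sh: "label_shattered m U f S"
  have low': "ample m (U(j := U j - {a})) (lower j b a S)"
    using ample_swap[OF low ne j ab] lower_swap[OF ab(3), of j S] by simp
  have up': "ample m (U(j := U j - {a})) (upper j b a S)"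
    using ample_swap[OF up ne j ab] upper_swap[OF ab(3), of j S] by simp
  show "\<exists>w. label_copy m U f S w"
  proof (cases "f j a = f j b")
    case True
    show ?thesis by (rule label_copy_of_merged[OF geo SU ne j ab low up sh True])
  next
    case False
    define pop where "pop c z \<longleftrightarrow> (\<exists>s\<in>S. s j \<noteq> c \<and> f j (s j) = f j c \<and> agree_off m j f s z)" for c z
    consider "\<forall>z\<in>cart m U. pop a z" | "\<forall>z\<in>cart m U. pop b z"
      | z1 z2 where "z1 \<in> cart m U" "\<not> pop a z1" "z2 \<in> cart m U" "\<not> pop b z2" by blast
    then show ?thesis
    proof cases
      case 1
      show ?thesis
        by (rule label_copy_of_populated[OF geo SU ne j ab(1,2) low up sh False 1[unfolded pop_def]])
    next
      case 2
      show ?thesis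
        by (rule label_copy_of_populated[OF geo SU ne j ab(2,1) low' up' sh False[symmetric] 2[unfolded pop_def]])
    next
      case 3
      have "\<forall>s\<in>S. agree_off m j f s z1 \<and> f j (s j) = f j a \<longrightarrow> s j = a"
        using 3(2) unfolding pop_def by (simp only: bex_simps) auto
      moreover have "\<forall>s\<in>S. agree_off m j f s z2 \<and> f j (s j) = f j b \<longrightarrow> s j = b"
        using 3(4) unfolding pop_def by (simp only: bex_simps) auto
      ultimately show ?thesis
        using label_copy_of_separated[OF geo SU j ab(1,2) low sh False 3(1) _ 3(3)] by blast
    qed
  qed
qed

section \<open>Connected sets with ample lower minors\<close>

lemma geodesic_extend:
  assumes SU: "S \<subseteq> cart m U"
    and low: "\<And>j a b. j < m \<Longrightarrow> a \<in> U j \<Longrightarrow> b \<in> U j \<Longrightarrow> a \<noteq> b \<Longrightarrow> geodesically_closed m (lower j a b S)"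
    and u: "u \<in> S" and j: "j < m" "u j \<noteq> b"
    and geo: "geodesic m S (u(j := b)) v"
  shows "geodesic m S u v"
proof (cases "v j = b")
  case True
  then show ?thesis using geodesic_step[OF u j(1), of v] geo j(2) by simp
next
  case False
  let ?x = "u(j := b)"
  have "?x j \<noteq> v j" using False by simp
  then obtain z where z: "z \<in> S" "z j = ?x j" "z(j := v j) \<in> S" "\<And>i. z i = ?x i \<or> z i = v i"
    "geodesic m S (z(j := v j)) v" using geodesic_cross[OF geo] by blast
  let ?t = "z(j := v j)"
  have xS: "?x \<in> S" using geodesic_in[OF geo] by blast
  have "u j \<in> U j" using PiE_mem[of u "{..<m}" U j] u SU j(1) by auto
  moreover have "b \<in> U j" using PiE_mem[of ?x "{..<m}" U j] xS SU j(1) by auto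
  ultimately have "geodesically_closed m (lower j (u j) b S)" using low j by blast
  moreover have "u \<in> lower j (u j) b S" using u xS j(2) by (simp add: lower_def)
  \<comment> \<open>If \<open>v j = u j\<close>, membership also requires the twin of
    \<open>?t\<close> at \<open>b\<close>; this is \<open>z\<close>, the vertex at which the given
    geodesic changes \<open>j\<close> back.\<close>
  moreover have "?t \<in> lower j (u j) b S"
  proof -
    have "z(j := b) = z" using z(2) by (simp add: fun_eq_iff)
    then show ?thesis using z(1,3) False by (simp add: lower_def)
  qed
  ultimately have "geodesic m (lower j (u j) b S) u ?t" unfolding geodesically_closed_def by blast
  then have "geodesic m S u ?t" by (rule geodesic_mono[OF _ lower_subset])
  then show ?thesis
  proof (rule geodesic_trans[OF _ z(5)])
    show "?t i = u i \<or> ?t i = v i" for i using z(4)[of i] by (cases "i = j") auto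
  qed
qed

text \<open>Geodesics to the end of a path are built backwards from that end, and
  \<open>geodesic_extend\<close> absorbs one more edge each time.\<close>

lemma connected_geodesically_closed:
  assumes SU: "S \<subseteq> cart m U" and conn: "hamming_connected m S"
    and low: "\<And>j a b. j < m \<Longrightarrow> a \<in> U j \<Longrightarrow> b \<in> U j \<Longrightarrow> a \<noteq> b \<Longrightarrow> geodesically_closed m (lower j a b S)"
  shows "geodesically_closed m S"
proof -
  have path: "geodesic m S (hd p) (last p)"
    if "p \<noteq> []" "set p \<subseteq> S" "successively (hamming_adj m) p" for p
    using that
  proof (induction p)
    case (Cons x p)
    show ?case
    proof (cases p)
      case Nil
      then show ?thesis using Cons.prems by (auto intro: geodesic_refl)
    next
      case (Cons y q)
      have S: "x \<in> S" "y \<in> S" and adj: "hamming_adj m x y" using Cons.prems Cons by auto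
      obtain i where i: "i < m" "x i \<noteq> y i" "y = x(i := y i)"
        by (rule hamming_adjE[OF adj subsetD[OF SU S(1)] subsetD[OF SU S(2)]])
      have "geodesic m S y (last p)" using Cons.IH Cons.prems Cons by auto
      then have g: "geodesic m S (x(i := y i)) (last p)" using i(3) by simp
      have "geodesic m S x (last p)" by (rule geodesic_extend[OF SU low S(1) i(1,2) g])
      then show ?thesis using Cons by simp
    qed
  qed simp
  show ?thesis
    unfolding geodesically_closed_def
  proof (intro ballI)
    fix u v assume "u \<in> S" "v \<in> S"
    with conn obtain p where p: "hamming_path m S u p v" unfolding hamming_connected_def by blast
    show "geodesic m S u v" using path[of p] p unfolding hamming_path_def by auto
  qed
qed

lemma ample_of_lowers:
  assumes geo: "geodesically_closed m S" and SU: "S \<subseteq> cart m U"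
    and ne: "\<And>i. i < m \<Longrightarrow> U i \<noteq> {}"
    and low: "\<And>j a b. j < m \<Longrightarrow> a \<in> U j \<Longrightarrow> b \<in> U j \<Longrightarrow> a \<noteq> b \<Longrightarrow>
      ample m (U(j := U j - {b})) (lower j a b S)"
  shows "ample m U S"
proof (rule ampleI[OF SU ne])
  fix f :: "nat \<Rightarrow> 'a \<Rightarrow> 'a set"
  assume sh: "label_shattered m U f S"
  have Umem: "s i \<in> U i" if "s \<in> S" "i < m" for s i
    using PiE_mem[of s "{..<m}" U i] that SU by auto
  define rich where "rich j z \<longleftrightarrow>
    (\<exists>s\<in>S. \<exists>t\<in>S. (\<forall>i<m. f i (s i) = f i (z i)) \<and> (\<forall>i<m. f i (t i) = f i (z i)) \<and> s j \<noteq> t j)" for j z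
  show "\<exists>w. label_copy m U f S w"
  proof (cases "\<exists>j<m. \<exists>x\<in>U j. \<forall>z\<in>cart m U. z j = x \<longrightarrow> rich j z")
    case True
    then obtain j x where j: "j < m" and x: "x \<in> U j" and rich: "\<And>z. z \<in> cart m U \<Longrightarrow> z j = x \<Longrightarrow> rich j z" by blast
    obtain z0 where z0: "z0 \<in> cart m U" "z0 j = x" by (rule cart_extend[where Z = U, OF ne j x])
    obtain a b where ab: "a \<in> U j" "b \<in> U j" "a \<noteq> b" "f j a = f j x" "f j b = f j x"
    proof -
      from rich[OF z0] obtain s t where "s \<in> S" "t \<in> S" "s j \<noteq> t j"
        "\<forall>i<m. f i (s i) = f i (z0 i)" "\<forall>i<m. f i (t i) = f i (z0 i)" unfolding rich_def by (elim bexE conjE) (rule that)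
      then show thesis using that[of "s j" "t j"] Umem j z0(2) by simp
    qed
    let ?V = "U(j := U j - {b})" and ?L = "lower j a b S"
    have V: "z \<in> cart m ?V \<longleftrightarrow> z \<in> cart m U \<and> z j \<noteq> b" for z by (rule cart_remove_iff[OF j])
    have inL: "s \<in> ?L \<longleftrightarrow> s \<in> S \<and> s j \<noteq> b \<and> (s j = a \<longrightarrow> s(j := b) \<in> S)" for s
      by (simp add: lower_def)
    have "label_shattered m ?V f ?L"
      unfolding label_shattered_def
    proof
      fix z assume "z \<in> cart m ?V"
      then have z: "z \<in> cart m U" using V by blast
      show "\<exists>s\<in>?L. \<forall>i<m. f i (s i) = f i (z i)"
      proof (cases "f j (z j) = f j x")
        case True
        from rich[OF cart_upd[OF z j x]] obtain s t where st: "s \<in> S" "t \<in> S" "s j \<noteq> t j"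
          "\<forall>i<m. f i (s i) = f i ((z(j := x)) i)" "\<forall>i<m. f i (t i) = f i ((z(j := x)) i)"
          unfolding rich_def by auto
        have s: "\<forall>i<m. f i (s i) = f i (z i)" using st(4) True by (metis fun_upd_other fun_upd_same)
        have t: "\<forall>i<m. f i (t i) = f i (z i)" using st(5) True by (metis fun_upd_other fun_upd_same)
        have square: "\<exists>s\<in>?L. \<forall>i<m. f i (s i) = f i (z i)"
          if s: "s \<in> S" "s j = a" "\<forall>i<m. f i (s i) = f i (z i)"
            and t: "t \<in> S" "t j = b" "\<forall>i<m. f i (t i) = f i (z i)" for s t
        proof -
          have "s j \<noteq> t j" using s(2) t(2) ab(3) by simp
          then obtain y where y: "y \<in> S" "y j = s j" "y(j := t j) \<in> S" "\<And>i. y i = s i \<or> y i = t i"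
            using geodesic_square[OF geo s(1) t(1)] by blast
          have "y \<in> ?L" unfolding inL using y(1-3) s(2) t(2) ab(3) by simp
          moreover have "f i (y i) = f i (z i)" if "i < m" for i
            using y(4)[of i] s(3) t(3) that by metis
          ultimately show ?thesis by blast
        qed
        \<comment> \<open>\<open>a\<close> and \<open>b\<close> were read off from one pattern only.
          Over any other, two different values either include one outside \<open>{a, b}\<close>, and
          then \<open>lower\<close> is met directly, or are \<open>a\<close> and \<open>b\<close>
          themselves.\<close>
        consider "s j \<noteq> a" "s j \<noteq> b" | "t j \<noteq> a" "t j \<noteq> b" | "s j = a" "t j = b" | "s j = b" "t j = a"
          using st(3) by metis
        then show ?thesis
        proof cases
          case 1
          then have "s \<in> ?L" unfolding inL using st(1) by blast
          then show ?thesis using s by blast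
        next
          case 2
          then have "t \<in> ?L" unfolding inL using st(2) by blast
          then show ?thesis using t by blast
        next
          case 3
          then show ?thesis using square[OF st(1) _ s st(2) _ t] by simp
        next
          case 4
          then show ?thesis using square[OF st(2) _ t st(1) _ s] by simp
        qed
      next
        case False
        obtain s where s: "s \<in> S" "\<forall>i<m. f i (s i) = f i (z i)" by (rule label_shatteredD[OF sh z])
        have "f j (s j) \<noteq> f j x" using s(2) j False by simp
        then have "s j \<noteq> a" "s j \<noteq> b" using ab(4,5) by auto
        then have "s \<in> ?L" unfolding inL using s(1) by blast
        then show ?thesis using s(2) by blast
      qed
    qed
    then obtain w where w: "label_copy m ?V f ?L w" using ampleD[OF low[OF j ab(1-3)]] by blast
    have "label_copy m U f S w"
      unfolding label_copy_def
    proof (intro conjI allI impI ballI)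
      fix i y assume iy: "i < m" "y \<in> U i"
      show "f i (w i (f i y)) = f i y"
      proof (cases "i = j \<and> y = b")
        case True
        then show ?thesis using label_copyD1[OF w j, of a] ab by simp
      next
        case False
        then show ?thesis using iy by (intro label_copyD1[OF w]) auto
      qed
    next
      fix z assume z: "z \<in> cart m U"
      define y where "y = (if z j = b then z(j := a) else z)"
      have "y \<in> cart m ?V" using z cart_upd[OF z j ab(1)] V ab(3) by (simp add: y_def)
      then have "select m w f y \<in> ?L" by (rule label_copyD2[OF w])
      moreover have "select m w f z = select m w f y" using ab by (intro select_cong) (auto simp: y_def)
      ultimately show "select m w f z \<in> S" using inL by simp
    qed
    then show ?thesis by blast
  next
    case False
    \<comment> \<open>The only point in which the pattern meets the block need not be
      \<open>x\<close>; it becomes the representative \<open>a\<close> of the block.\<close>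
    have poor: "\<exists>z a. z \<in> cart m U \<and> a \<in> U j \<and> f j a = f j x \<and>
        (\<forall>s\<in>S. agree_off m j f s z \<and> f j (s j) = f j a \<longrightarrow> s j = a)" if j: "j < m" and x: "x \<in> U j" for j x
    proof -
      obtain z where z: "z \<in> cart m U" "z j = x" "\<not> rich j z" using False j x by blast
      obtain s where s: "s \<in> S" "\<forall>i<m. f i (s i) = f i (z i)" by (rule label_shatteredD[OF sh z(1)])
      have fs: "f j (s j) = f j x" using s(2) j z(2) by simp
      have "t j = s j" if t: "t \<in> S" "agree_off m j f t z" "f j (t j) = f j (s j)" for t
      proof (rule ccontr)
        assume ts: "t j \<noteq> s j"
        have "f i (t i) = f i (z i)" if "i < m" for i
          using t(2,3) fs z(2) that by (cases "i = j") simp_all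
        then have "rich j z" unfolding rich_def using s t(1) ts by blast
        then show False using z(3) by blast
      qed
      then show ?thesis using z(1) Umem[OF s(1) j] fs by blast
    qed
    show ?thesis
    proof (cases "\<exists>j<m. \<exists>x\<in>U j. \<exists>y\<in>U j. f j x \<noteq> f j y")
      case True
      then obtain j x y where j: "j < m" and xy: "x \<in> U j" "y \<in> U j" "f j x \<noteq> f j y" by blast
      obtain z1 a where 1: "z1 \<in> cart m U" "a \<in> U j" "f j a = f j x"
        "\<forall>s\<in>S. agree_off m j f s z1 \<and> f j (s j) = f j a \<longrightarrow> s j = a" using poor[OF j xy(1)] by (elim exE conjE) (rule that)
      obtain z2 b where 2: "z2 \<in> cart m U" "b \<in> U j" "f j b = f j y"
        "\<forall>s\<in>S. agree_off m j f s z2 \<and> f j (s j) = f j b \<longrightarrow> s j = b" using poor[OF j xy(2)] by (elim exE conjE) (rule that)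
      have fab: "f j a \<noteq> f j b" using 1(3) 2(3) xy(3) by simp
      then have "a \<noteq> b" by blast
      then show ?thesis
        using label_copy_of_separated[OF geo SU j 1(2) 2(2) low[OF j 1(2) 2(2)] sh fab 1(1,4) 2(1,4)] by blast
    next
      case False
      have "cart m U \<noteq> {}" using ne PiE_eq_empty_iff[of "{..<m}" U] by blast
      then obtain s where s: "s \<in> S" using sh unfolding label_shattered_def by blast
      \<comment> \<open>Every factor is a single block, so any one point of \<open>S\<close> is a
        copy.\<close>
      have "label_copy m U f S (\<lambda>i k. s i)"
        unfolding label_copy_def
      proof (intro conjI allI impI ballI)
        fix i x assume "i < m" "x \<in> U i"
        then show "f i (s i) = f i x" using False Umem[OF s] by blast
      next
        fix z assume "z \<in> cart m U"
        have "s \<in> extensional {..<m}" using s SU by (auto simp: PiE_def)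
        then have "select m (\<lambda>i k. s i) f z = s" by (simp add: select_def extensional_restrict)
        then show "select m (\<lambda>i k. s i) f z \<in> S" using s by simp
      qed
      then show ?thesis by blast
    qed
  qed
qed

section \<open>Sets with ample intervals\<close>

text \<open>The measure is the total size of the factors, which drops both when points of a factor
  are deleted and when two of them are merged. The interval condition has to survive both
  reductions; for the merging this is where the choice of interval needs care.\<close>

lemma ample_of_intervals:
  fixes U :: "nat \<Rightarrow> 'a set"
  assumes "\<And>i. i < m \<Longrightarrow> finite (U i) \<and> U i \<noteq> {}" and "S \<subseteq> cart m U"
    and "\<And>u v. u \<in> S \<Longrightarrow> v \<in> S \<Longrightarrow> ample m (interval_factors u v) (S \<inter> cart m (interval_factors u v))"
  shows "ample m U S"
  using assms
proof (induction "\<Sum>i<m. card (U i)" arbitrary: U S rule: less_induct)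
  case less
  have fin: "finite (U i)" and ne: "U i \<noteq> {}" if "i < m" for i using less.prems(1)[OF that] by auto
  note SU = less.prems(2) and int = less.prems(3)
  have geo: "geodesically_closed m S" by (rule interval_ample_geodesic[OF SU int])
  have Umem: "s i \<in> U i" if "s \<in> S" "i < m" for s i
    using PiE_mem[of s "{..<m}" U i] that SU by auto
  have smaller: "(\<Sum>i<m. card (Z i)) < (\<Sum>i<m. card (U i))"
    if sub: "\<And>i. i < m \<Longrightarrow> Z i \<subseteq> U i" and k: "k < m" "Z k \<noteq> U k" for Z k
  proof (rule sum_strict_mono_ex1)
    show "\<forall>i\<in>{..<m}. card (Z i) \<le> card (U i)" using sub fin by (auto intro: card_mono)
    have "Z k \<subset> U k" using sub[OF k(1)] k(2) by blast
    then show "\<exists>i\<in>{..<m}. card (Z i) < card (U i)" using psubset_card_mono[OF fin[OF k(1)]] k(1) by blast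
  qed simp
  have box: "ample m Z (S \<inter> cart m Z)"
    if sub: "\<And>i. i < m \<Longrightarrow> Z i \<subseteq> U i" and Zne: "\<And>i. i < m \<Longrightarrow> Z i \<noteq> {}" and k: "k < m" "Z k \<noteq> U k" for Z k
  proof (rule less.hyps)
    show "(\<Sum>i<m. card (Z i)) < (\<Sum>i<m. card (U i))" by (rule smaller[OF sub k])
    show "finite (Z i) \<and> Z i \<noteq> {}" if "i < m" for i
      using Zne[OF that] finite_subset[OF sub[OF that] fin[OF that]] by blast
    show "S \<inter> cart m Z \<subseteq> cart m Z" by blast
    fix u v assume uv: "u \<in> S \<inter> cart m Z" "v \<in> S \<inter> cart m Z"
    have "cart m (interval_factors u v) \<subseteq> cart m Z"
      using PiE_mem[of u _ Z] PiE_mem[of v _ Z] uv by (intro PiE_mono) (auto simp: interval_factors_def)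
    then have "S \<inter> cart m Z \<inter> cart m (interval_factors u v) = S \<inter> cart m (interval_factors u v)" by blast
    then show "ample m (interval_factors u v) (S \<inter> cart m Z \<inter> cart m (interval_factors u v))"
      using int[of u v] uv by simp
  qed
  show ?case
  proof (rule ampleI[OF SU ne])
    fix f :: "nat \<Rightarrow> 'a \<Rightarrow> 'a set"
    assume sh: "label_shattered m U f S"
    show "\<exists>w. label_copy m U f S w"
    proof (rule ccontr)
      assume nocopy: "\<not> ?thesis"
      \<comment> \<open>Without \<open>c\<close> all labels remain in use, thanks to
        \<open>c'\<close>. If the smaller box were still shattered, its copy would be one for
        \<open>U\<close>; so some pattern over \<open>c\<close> is met at \<open>c\<close>
        only.\<close>
      have critical: "\<exists>z\<in>cart m U. z j = c \<and> (\<forall>s\<in>S. (\<forall>i<m. f i (s i) = f i (z i)) \<longrightarrow> s j = c)"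
        if j: "j < m" and c: "c \<in> U j" "c' \<in> U j" "c' \<noteq> c" "f j c' = f j c" for j c c'
      proof (rule ccontr)
        assume no: "\<not> ?thesis"
        let ?Z = "U(j := U j - {c})"
        have Z: "z \<in> cart m ?Z \<longleftrightarrow> z \<in> cart m U \<and> z j \<noteq> c" for z by (rule cart_remove_iff[OF j])
        have amp: "ample m ?Z (S \<inter> cart m ?Z)"
          using ne c by (intro box[of ?Z j] j) (auto split: if_splits)
        have "label_shattered m ?Z f (S \<inter> cart m ?Z)"
          unfolding label_shattered_def
        proof
          fix z assume "z \<in> cart m ?Z"
          then have z: "z \<in> cart m U" using Z by blast
          have "\<exists>s\<in>S. s j \<noteq> c \<and> (\<forall>i<m. f i (s i) = f i (z i))"
          proof (cases "f j (z j) = f j c")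
            case True
            have zc: "z(j := c) \<in> cart m U" by (rule cart_upd[OF z j c(1)])
            then obtain s where s: "s \<in> S" "\<forall>i<m. f i (s i) = f i ((z(j := c)) i)" "s j \<noteq> c"
              using no by auto
            have "f i (s i) = f i (z i)" if "i < m" for i
              using s(2)[rule_format, OF that] True by (cases "i = j") simp_all
            then show ?thesis using s by blast
          next
            case False
            obtain s where s: "s \<in> S" "\<forall>i<m. f i (s i) = f i (z i)" by (rule label_shatteredD[OF sh z])
            then have "s j \<noteq> c" using False j by auto
            then show ?thesis using s by blast
          qed
          then obtain s where s: "s \<in> S" "s j \<noteq> c" "\<forall>i<m. f i (s i) = f i (z i)" by (elim bexE conjE) (rule that)
          have "s \<in> cart m ?Z" using Z s(1,2) SU by auto
          then show "\<exists>s\<in>S \<inter> cart m ?Z. \<forall>i<m. f i (s i) = f i (z i)" using s(1,3) by (intro bexI[of _ s] IntI)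
        qed
        then obtain w where w: "label_copy m ?Z f (S \<inter> cart m ?Z) w" using ampleD[OF amp] by blast
        have "label_copy m U f S w"
          unfolding label_copy_def
        proof (intro conjI allI impI ballI)
          fix i x assume ix: "i < m" "x \<in> U i"
          show "f i (w i (f i x)) = f i x"
          proof (cases "i = j \<and> x = c")
            case True
            then show ?thesis using label_copyD1[OF w j, of c'] c by simp
          next
            case False
            then show ?thesis using ix by (intro label_copyD1[OF w]) auto
          qed
        next
          fix z assume z: "z \<in> cart m U"
          define y where "y = (if z j = c then z(j := c') else z)"
          have "y \<in> cart m ?Z" using z cart_upd[OF z j c(2)] Z c(3) by (simp add: y_def)
          then have "select m w f y \<in> S" using label_copyD2[OF w] by blast
          moreover have "select m w f z = select m w f y" using c by (intro select_cong) (auto simp: y_def)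
          ultimately show "select m w f z \<in> S" by simp
        qed
        then show False using nocopy by blast
      qed
      text \<open>A block with two points is the whole factor, and the critical boxes of these two
        points use every block of every factor: otherwise a smaller box would be shattered.\<close>
      have claim: "\<exists>z1\<in>cart m U. \<exists>z2\<in>cart m U. (\<forall>x\<in>U j. f j x = f j c1) \<and>
          (\<forall>i<m. i \<noteq> j \<longrightarrow> (\<forall>x\<in>U i. f i x = f i (z1 i) \<or> f i x = f i (z2 i))) \<and>
          (\<exists>i<m. i \<noteq> j \<and> f i (z1 i) \<noteq> f i (z2 i))"
        if j: "j < m" and c: "c1 \<in> U j" "c2 \<in> U j" "c1 \<noteq> c2" "f j c1 = f j c2" for j c1 c2
      proof -
        obtain z1 where z1: "z1 \<in> cart m U" "z1 j = c1"
          "\<forall>s\<in>S. (\<forall>i<m. f i (s i) = f i (z1 i)) \<longrightarrow> s j = c1"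
          using critical[OF j c(1,2) c(3)[symmetric] c(4)[symmetric]] by (elim bexE conjE) (rule that)
        obtain z2 where z2: "z2 \<in> cart m U" "z2 j = c2"
          "\<forall>s\<in>S. (\<forall>i<m. f i (s i) = f i (z2 i)) \<longrightarrow> s j = c2"
          using critical[OF j c(2,1,3,4)] by (elim bexE conjE) (rule that)
        define Z where "Z i = {x \<in> U i. f i x = f i (z1 i) \<or> f i x = f i (z2 i)}" for i
        have z12: "z1 \<in> cart m Z" "z2 \<in> cart m Z"
          using z1(1) z2(1) by (auto simp: PiE_iff Z_def)
        have full: "Z i = U i" if i: "i < m" for i
        proof (rule ccontr)
          assume nZ: "Z i \<noteq> U i"
          have amp: "ample m Z (S \<inter> cart m Z)"
            using nZ PiE_mem[OF z12(1)] by (intro box[of Z i] i) (auto simp: Z_def)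
          have "label_shattered m Z f (S \<inter> cart m Z)"
            unfolding label_shattered_def
          proof
            fix z assume z: "z \<in> cart m Z"
            have zm: "z i \<in> Z i" if "i < m" for i using PiE_mem[OF z] that by simp
            have "z \<in> cart m U" using z by (auto simp: PiE_iff Z_def)
            then obtain s where s: "s \<in> S" "\<forall>i<m. f i (s i) = f i (z i)" by (rule label_shatteredD[OF sh])
            have "s i \<in> Z i" if "i < m" for i
              using zm[OF that] s(2)[rule_format, OF that] Umem[OF s(1) that] by (simp add: Z_def)
            moreover have "s \<in> extensional {..<m}" using s(1) SU by (auto simp: PiE_def)
            ultimately have "s \<in> cart m Z" by (simp add: PiE_iff)
            then show "\<exists>s\<in>S \<inter> cart m Z. \<forall>i<m. f i (s i) = f i (z i)" using s by blast
          qed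
          then obtain w where w: "label_copy m Z f (S \<inter> cart m Z) w" using ampleD[OF amp] by blast
          have lab: "f i (select m w f z i) = f i (z i)" if "z \<in> cart m Z" "i < m" for z i
            using label_copyD1[OF w that(2) PiE_mem[OF that(1)]] that(2) by simp
          \<comment> \<open>A copy in the smaller box would have to choose both \<open>c1\<close>
            and \<open>c2\<close> for their common label.\<close>
          have "select m w f z1 j = c1" using z1(3) label_copyD2[OF w z12(1)] lab[OF z12(1)] by blast
          moreover have "select m w f z2 j = c2" using z2(3) label_copyD2[OF w z12(2)] lab[OF z12(2)] by blast
          ultimately show False using j c z1(2) z2(2) by simp
        qed
        have "\<exists>i<m. i \<noteq> j \<and> f i (z1 i) \<noteq> f i (z2 i)"
        proof (rule ccontr)
          assume no: "\<not> ?thesis"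
          obtain s where s: "s \<in> S" "\<forall>i<m. f i (s i) = f i (z1 i)" by (rule label_shatteredD[OF sh z1(1)])
          have "f i (s i) = f i (z2 i)" if "i < m" for i
            using no s(2)[rule_format, OF that] that z1(2) z2(2) c(4) by (cases "i = j") auto
          then have "s j = c2" using z2(3) s(1) by blast
          moreover have "s j = c1" using z1(3) s by blast
          ultimately show False using c(3) by simp
        qed
        moreover have "\<forall>i<m. \<forall>x\<in>U i. f i x = f i (z1 i) \<or> f i x = f i (z2 i)"
          using full by (auto simp: Z_def)
        moreover have "\<forall>x\<in>U j. f j x = f j c1"
          using full[OF j] z1(2) z2(2) c(4) by (auto simp: Z_def)
        ultimately show ?thesis using z1(1) z2(1) by blast
      qed
      show False
      proof (cases "\<forall>j<m. inj_on (f j) (U j)")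
        case True
        have "z \<in> S" if z: "z \<in> cart m U" for z
        proof -
          obtain s where s: "s \<in> S" "\<forall>i<m. f i (s i) = f i (z i)" by (rule label_shatteredD[OF sh z])
          have "s i = z i" if "i < m" for i
            by (rule inj_onD[OF True[rule_format, OF that]])
              (use that s(2) Umem[OF s(1) that] PiE_mem[OF z, of i] in auto)
          then have "s = z" using s(1) SU z by (intro PiE_ext[of s "{..<m}" U z]) auto
          then show ?thesis using s(1) by simp
        qed
        moreover have "select m (\<lambda>i. inv_into (U i) (f i)) f z = z" if z: "z \<in> cart m U" for z
        proof
          fix i show "select m (\<lambda>i. inv_into (U i) (f i)) f z i = z i"
            using True PiE_mem[OF z, of i] PiE_arb[OF z, of i] by (cases "i < m") (auto simp: select_def)
        qed
        ultimately have "label_copy m U f S (\<lambda>i. inv_into (U i) (f i))"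
          unfolding label_copy_def by (simp add: f_inv_into_f)
        then show False using nocopy by blast
      next
        case False
        then obtain j c1 c2 where j: "j < m" and c: "c1 \<in> U j" "c2 \<in> U j" "c1 \<noteq> c2" "f j c1 = f j c2"
          unfolding inj_on_def by blast
        obtain z1 z2 i where z: "z1 \<in> cart m U" "z2 \<in> cart m U"
            "\<forall>i<m. i \<noteq> j \<longrightarrow> (\<forall>x\<in>U i. f i x = f i (z1 i) \<or> f i x = f i (z2 i))"
          and i: "i < m" "i \<noteq> j" and ni: "f i (z1 i) \<noteq> f i (z2 i)"
          using claim[OF j c] by (elim bexE exE conjE) (rule that)
        define a b where "a = z1 i" and "b = z2 i"
        have ab: "a \<in> U i" "b \<in> U i" "f i a \<noteq> f i b" "a \<noteq> b"
          using PiE_mem[OF z(1), of i] PiE_mem[OF z(2), of i] i ni by (auto simp: a_def b_def)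
        \<comment> \<open>Otherwise \<open>claim\<close> makes factor \<open>i\<close> a single
          block, although \<open>a\<close> and \<open>b\<close> have different labels.\<close>
        have inj: "inj_on (f i) (U i)"
        proof (rule inj_onI, rule ccontr)
          fix x y assume "x \<in> U i" "y \<in> U i" "f i x = f i y" "x \<noteq> y"
          then have "\<forall>t\<in>U i. f i t = f i x" using claim[OF i(1), of x y] by blast
          then show False using ab(1-3) by metis
        qed
        have Ui: "x = a \<or> x = b" if "x \<in> U i" for x
        proof -
          have "f i x = f i a \<or> f i x = f i b" using z(3) i that by (simp add: a_def b_def)
          then show ?thesis using inj_onD[OF inj] that ab by blast
        qed
        let ?V = "U(i := U i - {b})" and ?L = "lower i a b S"
        have V: "z \<in> cart m ?V \<longleftrightarrow> z \<in> cart m U \<and> z i \<noteq> b" for z by (rule cart_remove_iff[OF i(1)])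
        have inL: "s \<in> ?L \<longleftrightarrow> s \<in> S \<and> s i = a \<and> s(i := b) \<in> S" for s
          using Ui Umem[of s i] i(1) ab(4) by (auto simp: lower_def)
        have amp: "ample m ?V ?L"
        proof (rule less.hyps)
          show "(\<Sum>k<m. card (?V k)) < (\<Sum>k<m. card (U k))"
            by (rule smaller[of _ i]) (use i ab in auto)
          show "finite (?V k) \<and> ?V k \<noteq> {}" if "k < m" for k using fin[OF that] ne[OF that] ab by auto
          show "?L \<subseteq> cart m ?V" by (rule lower_cart[OF i(1) SU])
          fix u v assume uv: "u \<in> ?L" "v \<in> ?L"
          \<comment> \<open>Merging \<open>a\<close> and \<open>b\<close> in
            \<open>[u, v(i := b)]\<close> gives \<open>[u, v]\<close>. The larger interval has both
            ends in \<open>S\<close>, because \<open>v\<close> is in \<open>lower\<close>, so its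
            ampleness passes to the minor by \<open>ample_lower\<close>.\<close>
          let ?J = "interval_factors u v" and ?I = "interval_factors u (v(i := b))"
          have "u \<in> S" "v(i := b) \<in> S" and uvi: "u i = a" "v i = a" using uv inL by auto
          then have "ample m ?I (S \<inter> cart m ?I)" by (intro int)
          then have "ample m (?I(i := ?I i - {b})) (lower i a b (S \<inter> cart m ?I))"
            by (rule ample_lower) (use i uvi ab in \<open>auto simp: interval_factors_def\<close>)
          moreover have IJ: "?I(i := ?I i - {b}) = ?J"
            using uvi ab(4) by (auto simp: interval_factors_def fun_eq_iff)
          moreover have "lower i a b (S \<inter> cart m ?I) = ?L \<inter> cart m ?J"
          proof -
            have J: "x \<in> cart m ?J \<longleftrightarrow> x \<in> cart m ?I \<and> x i \<noteq> b" for x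
              using cart_remove_iff[OF i(1), of x ?I b] unfolding IJ .
            have I: "x(i := b) \<in> cart m ?I" if "x \<in> cart m ?I" for x
              by (rule cart_upd[OF that i(1)]) (simp add: interval_factors_def)
            show ?thesis
            proof (rule set_eqI)
              fix x show "x \<in> lower i a b (S \<inter> cart m ?I) \<longleftrightarrow> x \<in> ?L \<inter> cart m ?J"
                unfolding lower_def mem_Collect_eq Int_iff J using I[of x] by argo
            qed
          qed
          ultimately show "ample m ?J (?L \<inter> cart m ?J)" by simp
        qed
        have "label_shattered m ?V f ?L"
          unfolding label_shattered_def
        proof
          fix z assume zV: "z \<in> cart m ?V"
          then have z: "z \<in> cart m U" "z i \<noteq> b" using V by auto
          then have za: "z i = a" using Ui PiE_mem[OF z(1), of i] i by auto
          obtain s where s: "s \<in> S" "\<forall>k<m. f k (s k) = f k (z k)" by (rule label_shatteredD[OF sh z(1)])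
          obtain t where t: "t \<in> S" "\<forall>k<m. f k (t k) = f k ((z(i := b)) k)"
            by (rule label_shatteredD[OF sh cart_upd[OF z(1) i(1) ab(2)]])
          have "f i (s i) = f i a" "f i (t i) = f i b" using s(2) t(2) i(1) za by auto
          then have st: "s i = a" "t i = b" using inj_onD[OF inj] Umem[OF s(1) i(1)] Umem[OF t(1) i(1)] ab by auto
          then have "s i \<noteq> t i" using ab by simp
          then obtain y where y: "y \<in> S" "y i = s i" "y(i := t i) \<in> S" "\<And>k. y k = s k \<or> y k = t k"
            using geodesic_square[OF geo s(1) t(1)] by blast
          have "y \<in> ?L" using inL[of y] y(1-3) st by simp
          moreover have "f k (y k) = f k (z k)" if "k < m" for k
          proof (cases "k = i")
            case True
            then show ?thesis using y(2) st za by simp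
          next
            case False
            then show ?thesis using y(4)[of k] s(2) t(2) that by (metis fun_upd_other)
          qed
          ultimately show "\<exists>s\<in>?L. \<forall>k<m. f k (s k) = f k (z k)" by blast
        qed
        then obtain w where w: "label_copy m ?V f ?L w" using ampleD[OF amp] by blast
        \<comment> \<open>All points of \<open>lower\<close> are at \<open>a\<close> in factor
          \<open>i\<close>; together with their twins at \<open>b\<close> they serve both labels of
          this factor.\<close>
        define w' where "w' k l = (if k = i then if l = f i a then a else b else w k l)" for k l
        have "label_copy m U f S w'"
          unfolding label_copy_def
        proof (intro conjI allI impI ballI)
          fix k x assume kx: "k < m" "x \<in> U k"
          show "f k (w' k (f k x)) = f k x"
          proof (cases "k = i")
            case True
            then show ?thesis using Ui[of x] kx by (auto simp: w'_def)
          next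
            case False
            then show ?thesis using label_copyD1[OF w kx(1), of x] kx by (simp add: w'_def)
          qed
        next
          fix z assume z: "z \<in> cart m U"
          have "z(i := a) \<in> cart m ?V" using cart_upd[OF z i(1) ab(1)] V ab(4) by simp
          then have s: "select m w f (z(i := a)) \<in> ?L" by (rule label_copyD2[OF w])
          have zi: "z i = a \<or> z i = b" using Ui PiE_mem[OF z, of i] i by simp
          then show "select m w' f z \<in> S"
          proof
            assume za: "z i = a"
            have "select m w' f z = (select m w f (z(i := a)))(i := a)"
              using za i(1) by (intro select_upd[symmetric]) (auto simp: w'_def)
            also have "\<dots> = select m w f (z(i := a))" using s inL by (metis fun_upd_triv)
            finally show ?thesis using s inL by simp
          next
            assume zb: "z i = b"
            have "select m w' f z = (select m w f (z(i := a)))(i := b)"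
              using zb i(1) ab(3) by (intro select_upd[symmetric]) (auto simp: w'_def)
            then show ?thesis using s inL by simp
          qed
        qed
        then show False using nocopy by blast
      qed
    qed
  qed
qed

section \<open>Elementary minors\<close>

lemma ample_map_iff:
  fixes Z :: "nat \<Rightarrow> 'a set" and Z' :: "nat \<Rightarrow> 'b set"
  assumes SZ: "S \<subseteq> cart m Z" and ne: "\<And>i. i < m \<Longrightarrow> Z i \<noteq> {}"
    and bij: "\<And>i. i < m \<Longrightarrow> bij_betw (\<phi> i) (Z i) (Z' i)"
  shows "ample m Z' ((\<lambda>x. \<lambda>i\<in>{..<m}. \<phi> i (x i)) ` S) \<longleftrightarrow> ample m Z S" (is "ample m Z' ?T \<longleftrightarrow> _")
proof
  assume amp: "ample m Z' ?T"
  define \<psi> where "\<psi> i = inv_into (Z i) (\<phi> i)" for i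
  have "ample m Z ((\<lambda>y. \<lambda>i\<in>{..<m}. \<psi> i (y i)) ` ?T)"
  proof (rule ample_map[OF amp])
    show "Z' i \<noteq> {}" if "i < m" for i using bij[OF that] ne[OF that] by (auto simp: bij_betw_def)
    show "bij_betw (\<psi> i) (Z' i) (Z i)" if "i < m" for i
      unfolding \<psi>_def by (rule bij_betw_inv_into[OF bij[OF that]])
  qed
  moreover have "(\<lambda>y. \<lambda>i\<in>{..<m}. \<psi> i (y i)) ` ?T = (\<lambda>x. x) ` S"
    unfolding image_image
  proof (rule image_cong[OF refl])
    fix x assume "x \<in> S"
    then have x: "x \<in> cart m Z" using SZ by blast
    show "(\<lambda>i\<in>{..<m}. \<psi> i ((\<lambda>i\<in>{..<m}. \<phi> i (x i)) i)) = x"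
    proof
      fix i show "(\<lambda>i\<in>{..<m}. \<psi> i ((\<lambda>i\<in>{..<m}. \<phi> i (x i)) i)) i = x i"
      proof (cases "i < m")
        case True
        then have "x i \<in> Z i" using PiE_mem[OF x, of i] by simp
        then show ?thesis using True bij[OF True] by (simp add: \<psi>_def bij_betw_def)
      next
        case False
        then show ?thesis using PiE_arb[OF x, of i] by simp
      qed
    qed
  qed
  ultimately show "ample m Z S" by simp
next
  assume "ample m Z S"
  then show "ample m Z' ?T" by (rule ample_map[OF _ ne bij])
qed

text \<open>The bijection from a factor with \<open>b\<close> deleted onto the blocks of the
  elementary partition; \<open>a\<close> goes to the block of size 2.\<close>

definition collapse :: "nat \<Rightarrow> 'a \<Rightarrow> 'a \<Rightarrow> nat \<Rightarrow> 'a \<Rightarrow> 'a set" where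
  "collapse j a b i x = (if i = j \<and> x = a then {a, b} else {x})"

definition collapses :: "nat \<Rightarrow> (nat \<Rightarrow> 'a set) \<Rightarrow> nat \<Rightarrow> 'a \<Rightarrow> 'a \<Rightarrow> (nat \<Rightarrow> 'a set set) \<Rightarrow> bool" where
  "collapses m U j a b e \<longleftrightarrow> j < m \<and> a \<in> U j \<and> b \<in> U j \<and> a \<noteq> b \<and>
     (\<forall>i<m. e i = collapse j a b i ` ((U(j := U j - {b})) i))"

lemma elementary_minor_collapses:
  assumes e: "e \<in> elementary_minors m U"
  obtains j a b where "collapses m U j a b e"
proof -
  have part: "partition_on (U i) (e i)" if "i < m" for i
    using e that by (auto simp: elementary_minors_def gen_partitions_def PiE_iff)
  from e have "elementary m e" by (simp add: elementary_minors_def)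
  then obtain j B where j: "j < m" and B: "B \<in> e j" "card B = 2"
    and one: "\<forall>i<m. \<forall>C\<in>e i. (i, C) \<noteq> (j, B) \<longrightarrow> card C = 1"
    unfolding elementary_def by (elim exE conjE bexE) (rule that)
  obtain a b where ab: "B = {a, b}" "a \<noteq> b" using B(2) unfolding card_2_iff by auto
  have abU: "a \<in> U j" "b \<in> U j" using partition_onD1[OF part[OF j]] B(1) ab(1) by auto
  have eqB: "C = B" if "C \<in> e j" "x \<in> C" "x \<in> B" for C x
    using partition_onD2[OF part[OF j]] that B(1) by (auto dest: disjointD)
  have single: "C = {x}" if C: "i < m" "C \<in> e i" "(i, C) \<noteq> (j, B)" "x \<in> C" for i C x
  proof -
    have "card C = 1" using one C by blast
    then show ?thesis using C(4) by (auto simp: card_1_singleton_iff)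
  qed
  have "e i = collapse j a b i ` ((U(j := U j - {b})) i)" if i: "i < m" for i
  proof (intro equalityI subsetI)
    fix C assume C: "C \<in> e i"
    show "C \<in> collapse j a b i ` ((U(j := U j - {b})) i)"
    proof (cases "i = j \<and> C = B")
      case True
      then show ?thesis using abU ab by (intro image_eqI[of _ _ a]) (auto simp: collapse_def)
    next
      case False
      obtain x where x: "x \<in> C" using partition_onD3[OF part[OF i]] C by (metis ex_in_conv)
      have Cx: "C = {x}" using single[OF i C _ x] False by blast
      have xU: "x \<in> U i" using partition_onD1[OF part[OF i]] C x by blast
      have "x \<noteq> a \<and> x \<noteq> b" if "i = j" using eqB[of C x] C x False that ab(1) by auto
      then show ?thesis using xU Cx by (intro image_eqI[of _ _ x]) (auto simp: collapse_def)
    qed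
  next
    fix C assume "C \<in> collapse j a b i ` ((U(j := U j - {b})) i)"
    then obtain x where x: "x \<in> U i" "i = j \<longrightarrow> x \<noteq> b" "C = collapse j a b i x"
      by (auto split: if_splits)
    obtain D where D: "D \<in> e i" "x \<in> D" using partition_onD1[OF part[OF i]] x(1) by blast
    show "C \<in> e i"
    proof (cases "i = j \<and> x = a")
      case True
      then show ?thesis using x(3) B(1) ab(1) by (simp add: collapse_def)
    next
      case False
      then have "(i, D) \<noteq> (j, B)" using D(2) x(2) ab(1) by auto
      then have "D = {x}" using single[OF i D(1) _ D(2)] by blast
      then show ?thesis using x(3) False D(1) by (auto simp: collapse_def)
    qed
  qed
  then have "collapses m U j a b e" using j abU ab(2) by (simp add: collapses_def)
  then show thesis by (rule that)
qed

lemma collapses_exists: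
  assumes j: "j < m" and ab: "a \<in> U j" "b \<in> U j" "a \<noteq> b"
  obtains e where "e \<in> elementary_minors m U" "collapses m U j a b e"
proof -
  let ?V = "U(j := U j - {b})"
  define e where "e = (\<lambda>i\<in>{..<m}. collapse j a b i ` ?V i)"
  have "partition_on (U i) (collapse j a b i ` ?V i)" for i
  proof (rule partition_onI)
    show "\<Union> (collapse j a b i ` ?V i) = U i"
      using ab by (auto simp: collapse_def split: if_splits)
    show "disjnt p q" if "p \<in> collapse j a b i ` ?V i" "q \<in> collapse j a b i ` ?V i" "p \<noteq> q" for p q
      using that by (auto simp: collapse_def disjnt_def split: if_splits)
    show "{} \<notin> collapse j a b i ` ?V i" by (auto simp: collapse_def)
  qed
  then have "e \<in> gen_partitions m U" by (auto simp: gen_partitions_def e_def)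
  moreover have "elementary m e"
    unfolding elementary_def
  proof (intro exI[of _ j] conjI j bexI[of _ "{a, b}"] allI impI ballI)
    show "card {a, b} = 2" using ab(3) by simp
    show "{a, b} \<in> e j" using j ab by (auto simp: e_def collapse_def intro!: image_eqI[of _ _ a])
    fix i C assume "i < m" "C \<in> e i" "(i, C) \<noteq> (j, {a, b})"
    then show "card C = 1" by (auto simp: e_def collapse_def split: if_splits)
  qed
  moreover have "collapses m U j a b e" using j ab by (simp add: collapses_def e_def)
  ultimately show thesis by (intro that) (simp_all add: elementary_minors_def)
qed

lemma collapse_box:
  assumes j: "j < m" and x: "x \<in> cart m Z"
  shows "cart m (\<lambda>i\<in>{..<m}. collapse j a b i (x i)) = (if x j = a then {x, x(j := b)} else {x})"
proof (rule set_eqI)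
  fix y
  have "y \<in> cart m (\<lambda>i\<in>{..<m}. collapse j a b i (x i)) \<longleftrightarrow>
      (\<forall>i<m. y i \<in> collapse j a b i (x i)) \<and> y \<in> extensional {..<m}"
    by (auto simp: PiE_iff)
  also have "\<dots> \<longleftrightarrow> y = x \<or> (x j = a \<and> y = x(j := b))"
  proof
    assume y: "(\<forall>i<m. y i \<in> collapse j a b i (x i)) \<and> y \<in> extensional {..<m}"
    have off: "y i = x i" if "i \<noteq> j" for i
    proof (cases "i < m")
      case True
      then show ?thesis using y that by (auto simp: collapse_def)
    next
      case False
      then show ?thesis using y PiE_arb[OF x, of i] by (simp add: extensional_def)
    qed
    then have "y = x(j := y j)" by (simp add: fun_eq_iff)
    moreover have "y j = x j \<or> (x j = a \<and> y j = b)" using y j by (auto simp: collapse_def split: if_splits)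
    ultimately show "y = x \<or> (x j = a \<and> y = x(j := b))" by (metis fun_upd_triv)
  next
    assume "y = x \<or> (x j = a \<and> y = x(j := b))"
    then show "(\<forall>i<m. y i \<in> collapse j a b i (x i)) \<and> y \<in> extensional {..<m}"
      using x j by (auto simp: collapse_def PiE_iff extensional_def)
  qed
  finally show "y \<in> cart m (\<lambda>i\<in>{..<m}. collapse j a b i (x i)) \<longleftrightarrow> y \<in> (if x j = a then {x, x(j := b)} else {x})"
    by auto
qed

text \<open>Coordinatewise \<open>collapse\<close> is a bijection onto the minor. The box of
  \<open>x\<close> is \<open>{x, x(j := b)}\<close> or \<open>{x}\<close>, so the boxes inside
  \<open>S\<close> correspond to \<open>lower\<close> and those meeting \<open>S\<close> to
  \<open>upper\<close>.\<close>

lemma ample_collapse_iff: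
  assumes SU: "S \<subseteq> cart m U" and ne: "\<And>i. i < m \<Longrightarrow> U i \<noteq> {}" and e: "collapses m U j a b e"
  shows "ample m e (minor_contained m e S) \<longleftrightarrow> ample m (U(j := U j - {b})) (lower j a b S)" (is ?lower)
    and "ample m e (minor_meet m e S) \<longleftrightarrow> ample m (U(j := U j - {b})) (upper j a b S)" (is ?upper)
proof -
  let ?V = "U(j := U j - {b})" and ?c = "\<lambda>x. \<lambda>i\<in>{..<m}. collapse j a b i (x i)"
  have j: "j < m" and ab: "a \<in> U j" "b \<in> U j" "a \<noteq> b"
    and ei: "\<And>i. i < m \<Longrightarrow> e i = collapse j a b i ` ?V i" using e by (auto simp: collapses_def)
  have V: "z \<in> cart m ?V \<longleftrightarrow> z \<in> cart m U \<and> z j \<noteq> b" for z by (rule cart_remove_iff[OF j])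
  have Vne: "?V i \<noteq> {}" if "i < m" for i using ne[OF that] ab by auto
  have bij: "bij_betw (collapse j a b i) (?V i) (e i)" if "i < m" for i
    unfolding bij_betw_def ei[OF that] by (auto simp: inj_on_def collapse_def split: if_splits)
  have cart_e: "cart m e = ?c ` cart m ?V"
  proof (intro equalityI subsetI)
    fix P assume P: "P \<in> cart m e"
    have "\<forall>i\<in>{..<m}. \<exists>x. x \<in> ?V i \<and> P i = collapse j a b i x" using PiE_mem[OF P] ei by fastforce
    then obtain x where x: "\<forall>i\<in>{..<m}. x i \<in> ?V i \<and> P i = collapse j a b i (x i)" by (rule bchoice[THEN exE])
    have "restrict x {..<m} \<in> cart m ?V" using x unfolding restrict_PiE_iff by blast
    moreover have "P = ?c (restrict x {..<m})"
    proof
      fix i show "P i = ?c (restrict x {..<m}) i"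
        using x PiE_arb[OF P, of i] by (cases "i < m") auto
    qed
    ultimately show "P \<in> ?c ` cart m ?V" by blast
  next
    fix P assume "P \<in> ?c ` cart m ?V"
    then obtain x where x: "x \<in> cart m ?V" "P = ?c x" by blast
    show "P \<in> cart m e"
      unfolding x(2) restrict_PiE_iff using PiE_mem[OF x(1)] ei by blast
  qed
  have box: "cart m (?c x) = (if x j = a then {x, x(j := b)} else {x})" if "x \<in> cart m ?V" for x
    by (rule collapse_box[OF j that])
  have "minor_contained m e S = ?c ` {x \<in> cart m ?V. cart m (?c x) \<subseteq> S}"
    unfolding minor_contained_def cart_e by blast
  also have "{x \<in> cart m ?V. cart m (?c x) \<subseteq> S} = lower j a b S"
  proof (rule set_eqI)
    fix x
    show "x \<in> {x \<in> cart m ?V. cart m (?c x) \<subseteq> S} \<longleftrightarrow> x \<in> lower j a b S"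
    proof (cases "x \<in> cart m ?V")
      case True
      then show ?thesis using box[OF True] V[of x] by (auto simp: lower_def)
    next
      case False
      then show ?thesis using lower_cart[OF j SU, of a b] by blast
    qed
  qed
  finally have low: "minor_contained m e S = ?c ` lower j a b S" .
  show ?lower
    unfolding low by (rule ample_map_iff[OF lower_cart[OF j SU] Vne bij])
  have "minor_meet m e S = ?c ` {x \<in> cart m ?V. cart m (?c x) \<inter> S \<noteq> {}}"
    unfolding minor_meet_def cart_e by blast
  also have "{x \<in> cart m ?V. cart m (?c x) \<inter> S \<noteq> {}} = upper j a b S"
  proof (rule set_eqI)
    fix x
    show "x \<in> {x \<in> cart m ?V. cart m (?c x) \<inter> S \<noteq> {}} \<longleftrightarrow> x \<in> upper j a b S"
    proof (cases "x \<in> cart m ?V")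
      case True
      have "x \<in> upper j a b S" if "x j = a" "x(j := b) \<in> S"
        unfolding upper_def using that by (intro image_eqI[of _ _ "x(j := b)"]) (auto simp: fun_eq_iff)
      moreover have "x \<in> upper j a b S" if "x \<in> S"
        unfolding upper_def using that True V[of x] by (intro image_eqI[of _ _ x]) auto
      moreover have "x \<in> S \<or> (x j = a \<and> x(j := b) \<in> S)" if up: "x \<in> upper j a b S"
      proof -
        obtain y where y: "y \<in> S" "x = (if y j = b then y(j := a) else y)" using up by (auto simp: upper_def)
        show ?thesis
        proof (cases "y j = b")
          case True
          then have "x(j := b) = y" "x j = a" using y(2) by (simp_all add: fun_eq_iff)
          then show ?thesis using y(1) by simp
        qed (use y in simp)
      qed
      ultimately show ?thesis using box[OF True] True by (auto split: if_splits)
    next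
      case False
      then show ?thesis using upper_cart[OF j SU ab(1,3)] by blast
    qed
  qed
  finally have up: "minor_meet m e S = ?c ` upper j a b S" .
  show ?upper
    unfolding up by (rule ample_map_iff[OF upper_cart[OF j SU ab(1,3)] Vne bij])
qed

text \<open>The equivalence with (2) is stated for products with at least two points in some factor.
  If all factors are singletons, there is no elementary minor for (2) to exhibit, whereas the empty
  set and the single point are both ample.\<close>

theorem theorem3:
  fixes m :: nat and U :: "nat \<Rightarrow> 'a set" and S :: "(nat \<Rightarrow> 'a) set"
  assumes "\<And>i. i < m \<Longrightarrow> finite (U i) \<and> U i \<noteq> {}"
    and "S \<subseteq> cart m U"
  shows "((\<exists>i<m. card (U i) \<ge> 2) \<longrightarrow>
           (ample m U S \<longleftrightarrow>
             hamming_isometric m S \<and>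
             (\<exists>e\<in>elementary_minors m U.
                ample m e (minor_contained m e S) \<and> ample m e (minor_meet m e S))))
       \<and> (ample m U S \<longleftrightarrow>
           hamming_connected m S \<and>
           (\<forall>e\<in>elementary_minors m U. ample m e (minor_contained m e S)))
       \<and> (ample m U S \<longleftrightarrow>
           (\<forall>u\<in>S. \<forall>v\<in>S.
              ample m (interval_factors u v) (S \<inter> cart m (interval_factors u v))))"
proof -
  have ne: "U i \<noteq> {}" if "i < m" for i using assms(1)[OF that] by blast
  note SU = assms(2)
  note iff = ample_collapse_iff[OF SU ne]
  have iso: "hamming_isometric m S" if "ample m U S"
    using ample_geodesically_closed[OF that] hamming_isometric_iff[OF SU] by blast
  have contained: "ample m e (minor_contained m e S)" and meet: "ample m e (minor_meet m e S)"
    if amp: "ample m U S" and e: "e \<in> elementary_minors m U" for e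
  proof -
    obtain j a b where c: "collapses m U j a b e" using elementary_minor_collapses[OF e] .
    then have j: "j < m" and ab: "a \<in> U j" "b \<in> U j" "a \<noteq> b" by (auto simp: collapses_def)
    show "ample m e (minor_contained m e S)"
      using iff(1)[OF _ c] ne ample_lower[OF amp ne j ab] by blast
    show "ample m e (minor_meet m e S)"
      using iff(2)[OF _ c] ne ample_upper[OF amp ne j ab] by blast
  qed
  have 2: "ample m U S \<longleftrightarrow> hamming_isometric m S \<and> (\<exists>e\<in>elementary_minors m U.
      ample m e (minor_contained m e S) \<and> ample m e (minor_meet m e S))"
    if big: "\<exists>i<m. card (U i) \<ge> 2"
  proof (intro iffI conjI; (elim conjE)?)
    assume amp: "ample m U S"
    then show "hamming_isometric m S" by (rule iso)
    from big obtain j where j: "j < m" "card (U j) \<ge> 2" by blast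
    obtain a b where ab: "a \<in> U j" "b \<in> U j" "a \<noteq> b"
    proof -
      have "\<not> (\<exists>x. U j \<subseteq> {x})" using j(2) card_mono[of "{x}" "U j" for x] by force
      then show thesis using that ne[OF j(1)] by blast
    qed
    then obtain e where "e \<in> elementary_minors m U" using collapses_exists[where U = U and j = j, OF j(1) ab] by blast
    then show "\<exists>e\<in>elementary_minors m U.
        ample m e (minor_contained m e S) \<and> ample m e (minor_meet m e S)"
      using contained[OF amp] meet[OF amp] by blast
  next
    assume isom: "hamming_isometric m S" and "\<exists>e\<in>elementary_minors m U.
        ample m e (minor_contained m e S) \<and> ample m e (minor_meet m e S)"
    then obtain e where e: "e \<in> elementary_minors m U"
      "ample m e (minor_contained m e S)" "ample m e (minor_meet m e S)" by blast
    obtain j a b where c: "collapses m U j a b e" using elementary_minor_collapses[OF e(1)] .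
    then have j: "j < m" and ab: "a \<in> U j" "b \<in> U j" "a \<noteq> b" by (auto simp: collapses_def)
    have low: "ample m (U(j := U j - {b})) (lower j a b S)" using iff(1)[OF _ c] ne e(2) by blast
    have up: "ample m (U(j := U j - {b})) (upper j a b S)" using iff(2)[OF _ c] ne e(3) by blast
    have geo: "geodesically_closed m S" using isom hamming_isometric_iff[OF SU] by blast
    show "ample m U S" by (rule ample_of_lower_upper[OF geo SU ne j ab low up])
  qed
  have 3: "ample m U S \<longleftrightarrow> hamming_connected m S \<and>
      (\<forall>e\<in>elementary_minors m U. ample m e (minor_contained m e S))"
  proof (intro iffI conjI ballI; (elim conjE)?)
    assume amp: "ample m U S"
    then show "hamming_connected m S" using iso hamming_isometric_connected by blast
    show "ample m e (minor_contained m e S)" if "e \<in> elementary_minors m U" for e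
      by (rule contained[OF amp that])
  next
    assume conn: "hamming_connected m S"
      and all: "\<forall>e\<in>elementary_minors m U. ample m e (minor_contained m e S)"
    have low: "ample m (U(j := U j - {b})) (lower j a b S)"
      if j: "j < m" and ab: "a \<in> U j" "b \<in> U j" "a \<noteq> b" for j a b
    proof -
      obtain e where e: "e \<in> elementary_minors m U" "collapses m U j a b e"
        by (rule collapses_exists[where U = U and j = j, OF j ab])
      then show ?thesis using iff(1)[OF _ e(2)] ne all by blast
    qed
    have "geodesically_closed m S"
      using low by (intro connected_geodesically_closed[OF SU conn] ample_geodesically_closed)
    then show "ample m U S" using low by (intro ample_of_lowers[OF _ SU ne])
  qed
  have 4: "ample m U S \<longleftrightarrow> (\<forall>u\<in>S. \<forall>v\<in>S.
      ample m (interval_factors u v) (S \<inter> cart m (interval_factors u v)))"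
  proof
    assume "ample m U S"
    then show "\<forall>u\<in>S. \<forall>v\<in>S. ample m (interval_factors u v) (S \<inter> cart m (interval_factors u v))"
      by (blast intro: ample_inter_interval)
  next
    assume "\<forall>u\<in>S. \<forall>v\<in>S. ample m (interval_factors u v) (S \<inter> cart m (interval_factors u v))"
    then show "ample m U S" using ample_of_intervals[OF assms(1) SU] by blast
  qed
  from 2 3 4 show ?thesis by blast
qed

end
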